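(* Consider the following two statements. (T) Every vector lattice with a strong truncation contains a maximal ideal. (U) Every vector lattice with a strong unit contains a maximal ideal. Then (T) and (U) are equivalent in ZF set theory.
   Context: All vector lattices are real, and $X_+$ denotes the positive cone $\{x\in X : x\ge 0\}$ of a vector lattice $X$. A truncation on a vector lattice $X$ is any unary operation $\ast$ on $X_+$ satisfying $x^{\ast}\wedge y = x\wedge y^{\ast}$ for all $x,y\in X_+$. A truncation $\ast$ on $X$ is strong if, for every $x\in X_+$, there exists $\lambda\in(0,\infty)$ such that $(\lambda x)^{\ast}=\lambda x$. An ideal of $X$ is a vector subspace $J$ of $X$ such that, for every $x,y\in X$, $|x|\le |y|$ and $y\in J$ imply $x\in J$. A maximal ideal is a proper ideal (that is, an ideal different from $X$) that is not properly contained in any other proper ideal of $X$. For $y\in X_+$, the smallest ideal of $X$ containing $y$ is $J_y=\{x\in X : |x|\le\lambda y \text{ for some } \lambda\in(0,\infty)\}$. The element $y$ is a strong unit of $X$ if $X=J_y$. *)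

theory Defs
  imports "HOL-Algebra.Module" "HOL-Algebra.Lattice"
begin

text \<open>
  HOL has a choice operator, so a claim "equivalent in ZF" cannot be read as an equivalence of two
  HOL propositions about HOL vector lattices.  It is read as: the equivalence holds in every model
  of the first-order theory ZF.  A model is an arbitrary type \<open>'v\<close> of "sets" with a binary
  relation \<open>\<epsilon>\<close>.  Separation and Replacement are restricted to first-order formulas (with
  parameters), so that the choice operator of HOL does not yield choice in the model.
\<close>

section \<open>Models of ZF\<close>

text \<open>Variables are natural numbers; \<open>All n p\<close> binds the variable \<open>n\<close> in \<open>p\<close>.\<close>

datatype fm = Mem nat nat | Eq nat nat | Neg fm | And fm fm | All nat fm

primrec sat :: "('v \<Rightarrow> 'v \<Rightarrow> bool) \<Rightarrow> (nat \<Rightarrow> 'v) \<Rightarrow> fm \<Rightarrow> bool" where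
  "sat E s (Mem i j) \<longleftrightarrow> E (s i) (s j)"
| "sat E s (Eq i j) \<longleftrightarrow> s i = s j"
| "sat E s (Neg p) \<longleftrightarrow> \<not> sat E s p"
| "sat E s (And p q) \<longleftrightarrow> sat E s p \<and> sat E s q"
| "sat E s (All n p) \<longleftrightarrow> (\<forall>a. sat E (s(n := a)) p)"

text \<open>
  In the two schemes the formula \<open>p\<close> speaks about \<open>x\<close> through variable 0 and about \<open>y\<close> through
  variable 1; the values of all other variables under \<open>s\<close> are the parameters.
\<close>

locale ZF_model =
  fixes E :: "'v \<Rightarrow> 'v \<Rightarrow> bool" (infix "\<epsilon>" 50)
  assumes extensionality: "\<forall>a b. (\<forall>x. x \<epsilon> a \<longleftrightarrow> x \<epsilon> b) \<longrightarrow> a = b"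
    and foundation: "\<forall>a. (\<exists>x. x \<epsilon> a) \<longrightarrow> (\<exists>x. x \<epsilon> a \<and> \<not> (\<exists>y. y \<epsilon> x \<and> y \<epsilon> a))"
    and pairing: "\<forall>a b. \<exists>c. \<forall>x. x \<epsilon> c \<longleftrightarrow> x = a \<or> x = b"
    and union: "\<forall>a. \<exists>u. \<forall>x. x \<epsilon> u \<longleftrightarrow> (\<exists>y. x \<epsilon> y \<and> y \<epsilon> a)"
    and power_set: "\<forall>a. \<exists>c. \<forall>x. x \<epsilon> c \<longleftrightarrow> (\<forall>y. y \<epsilon> x \<longrightarrow> y \<epsilon> a)"
    and infinity: "\<exists>w. (\<exists>e. e \<epsilon> w \<and> (\<forall>x. \<not> x \<epsilon> e)) \<and>
      (\<forall>x. x \<epsilon> w \<longrightarrow> (\<exists>y. y \<epsilon> w \<and> (\<forall>z. z \<epsilon> y \<longleftrightarrow> z \<epsilon> x \<or> z = x)))"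
    and separation: "\<forall>p s a. \<exists>b. \<forall>x. x \<epsilon> b \<longleftrightarrow> x \<epsilon> a \<and> sat E (s(0 := x)) p"
    and replacement: "\<forall>p s a. (\<forall>x. x \<epsilon> a \<longrightarrow> (\<exists>!y. sat E (s(0 := x, 1 := y)) p)) \<longrightarrow>
      (\<exists>b. \<forall>y. y \<epsilon> b \<longleftrightarrow> (\<exists>x. x \<epsilon> a \<and> sat E (s(0 := x, 1 := y)) p))"

section \<open>Structures inside a model\<close>

text \<open>
  A structure is given by elements of the model: its carrier, its operations (set-theoretic
  functions, i.e. sets of Kuratowski pairs) and its order (a set of pairs).  Below, every
  quantifier ranges over elements of the model or over tuples of such elements; the HOL sets that
  occur are extensions of elements of the model or classes definable from them.  The locales
  \<^locale>\<open>field\<close>, \<^locale>\<open>module\<close>, \<^locale>\<open>submodule\<close>, \<^locale>\<open>lattice\<close> and \<^locale>\<open>total_order\<close> quantify over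
  elements of the carriers only, so they say the same about a structure as its internal ZF
  counterparts.  This is not so for order completeness, which is therefore stated for the subsets
  that exist in the model.
\<close>

record 'v ordered_field_sys =
  fcarrier :: 'v
  fadd :: 'v
  fmult :: 'v
  fzero :: 'v
  fone :: 'v
  fle :: 'v

record 'v vector_lattice_sys =
  vcarrier :: 'v
  vadd :: 'v
  vzero :: 'v
  vsmult :: 'v
  vle :: 'v

context
  fixes E :: "'v \<Rightarrow> 'v \<Rightarrow> bool" (infix "\<epsilon>" 50)
begin

definition elts :: "'v \<Rightarrow> 'v set" where
  "elts a = {x. x \<epsilon> a}"

definition upair :: "'v \<Rightarrow> 'v \<Rightarrow> 'v" where
  "upair a b = (THE c. \<forall>x. x \<epsilon> c \<longleftrightarrow> x = a \<or> x = b)"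

definition opair :: "'v \<Rightarrow> 'v \<Rightarrow> 'v" where
  "opair a b = upair (upair a a) (upair a b)"

definition pairs :: "'v set \<Rightarrow> 'v set \<Rightarrow> 'v set" where
  "pairs A B = {opair a b | a b. a \<in> A \<and> b \<in> B}"

definition is_fun :: "'v \<Rightarrow> 'v set \<Rightarrow> 'v set \<Rightarrow> bool" where
  "is_fun f A B \<longleftrightarrow> elts f \<subseteq> pairs A B \<and> (\<forall>a\<in>A. \<exists>!b. opair a b \<epsilon> f)"

definition app :: "'v \<Rightarrow> 'v \<Rightarrow> 'v" where
  "app f a = (THE b. opair a b \<epsilon> f)"

subsection \<open>The real numbers\<close>

definition fring :: "'v ordered_field_sys \<Rightarrow> 'v ring" where
  "fring R = \<lparr>carrier = elts (fcarrier R),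
     mult = (\<lambda>x y. app (fmult R) (opair x y)), one = fone R,
     zero = fzero R, add = (\<lambda>x y. app (fadd R) (opair x y))\<rparr>"

definition forder :: "'v ordered_field_sys \<Rightarrow> 'v gorder" where
  "forder R = \<lparr>carrier = elts (fcarrier R), eq = (=), le = (\<lambda>x y. opair x y \<epsilon> fle R)\<rparr>"

text \<open>
  ZF proves that there is a Dedekind complete ordered field and that it is unique up to a unique
  isomorphism; "the real numbers" of the model are any such structure.
\<close>

definition is_reals :: "'v ordered_field_sys \<Rightarrow> bool" where
  "is_reals R \<longleftrightarrow>
     (let K = elts (fcarrier R); F = fring R; L = forder R in
       is_fun (fadd R) (pairs K K) K \<and> is_fun (fmult R) (pairs K K) K \<and>
       elts (fle R) \<subseteq> pairs K K \<and>
       field F \<and> total_order L \<and>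
       (\<forall>x\<in>K. \<forall>y\<in>K. \<forall>z\<in>K. x \<sqsubseteq>\<^bsub>L\<^esub> y \<longrightarrow> x \<oplus>\<^bsub>F\<^esub> z \<sqsubseteq>\<^bsub>L\<^esub> y \<oplus>\<^bsub>F\<^esub> z) \<and>
       (\<forall>x\<in>K. \<forall>y\<in>K. \<zero>\<^bsub>F\<^esub> \<sqsubseteq>\<^bsub>L\<^esub> x \<and> \<zero>\<^bsub>F\<^esub> \<sqsubseteq>\<^bsub>L\<^esub> y \<longrightarrow> \<zero>\<^bsub>F\<^esub> \<sqsubseteq>\<^bsub>L\<^esub> x \<otimes>\<^bsub>F\<^esub> y) \<and>
       (\<forall>S. elts S \<subseteq> K \<and> elts S \<noteq> {} \<and> Upper L (elts S) \<noteq> {} \<longrightarrow>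
          (\<exists>u. least L u (Upper L (elts S)))))"

text \<open>The interval \<open>(0,\<infinity>)\<close>.\<close>

definition pos_reals :: "'v ordered_field_sys \<Rightarrow> 'v set" where
  "pos_reals R = {r \<in> elts (fcarrier R). fzero R \<sqsubset>\<^bsub>forder R\<^esub> r}"

subsection \<open>Vector lattices\<close>

text \<open>
  The fields \<^const>\<open>mult\<close> and \<^const>\<open>one\<close> are part of the record type of modules but play no role
  in \<^locale>\<open>module\<close>.
\<close>

definition vmodule :: "'v vector_lattice_sys \<Rightarrow> ('v, 'v) module" where
  "vmodule X = \<lparr>carrier = elts (vcarrier X), mult = undefined, one = undefined,
     zero = vzero X, add = (\<lambda>x y. app (vadd X) (opair x y)),
     smult = (\<lambda>r x. app (vsmult X) (opair r x))\<rparr>"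

definition vorder :: "'v vector_lattice_sys \<Rightarrow> 'v gorder" where
  "vorder X = \<lparr>carrier = elts (vcarrier X), eq = (=), le = (\<lambda>x y. opair x y \<epsilon> vle X)\<rparr>"

definition vector_lattice :: "'v ordered_field_sys \<Rightarrow> 'v vector_lattice_sys \<Rightarrow> bool" where
  "vector_lattice R X \<longleftrightarrow>
     (let K = elts (fcarrier R); V = elts (vcarrier X); M = vmodule X; L = vorder X in
       is_fun (vadd X) (pairs V V) V \<and> is_fun (vsmult X) (pairs K V) V \<and>
       elts (vle X) \<subseteq> pairs V V \<and>
       module (fring R) M \<and> lattice L \<and>
       (\<forall>x\<in>V. \<forall>y\<in>V. \<forall>z\<in>V. x \<sqsubseteq>\<^bsub>L\<^esub> y \<longrightarrow> x \<oplus>\<^bsub>M\<^esub> z \<sqsubseteq>\<^bsub>L\<^esub> y \<oplus>\<^bsub>M\<^esub> z) \<and>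
       (\<forall>r\<in>pos_reals R. \<forall>x\<in>V. \<forall>y\<in>V. x \<sqsubseteq>\<^bsub>L\<^esub> y \<longrightarrow> r \<odot>\<^bsub>M\<^esub> x \<sqsubseteq>\<^bsub>L\<^esub> r \<odot>\<^bsub>M\<^esub> y))"

definition pos_cone :: "'v vector_lattice_sys \<Rightarrow> 'v set" where
  "pos_cone X = {x \<in> elts (vcarrier X). vzero X \<sqsubseteq>\<^bsub>vorder X\<^esub> x}"

definition vabs :: "'v vector_lattice_sys \<Rightarrow> 'v \<Rightarrow> 'v" where
  "vabs X x = x \<squnion>\<^bsub>vorder X\<^esub> (\<ominus>\<^bsub>vmodule X\<^esub> x)"

definition vl_ideal :: "'v ordered_field_sys \<Rightarrow> 'v vector_lattice_sys \<Rightarrow> 'v \<Rightarrow> bool" where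
  "vl_ideal R X J \<longleftrightarrow>
     submodule (elts J) (fring R) (vmodule X) \<and>
     (\<forall>x\<in>elts (vcarrier X). \<forall>y\<in>elts (vcarrier X).
        vabs X x \<sqsubseteq>\<^bsub>vorder X\<^esub> vabs X y \<and> y \<epsilon> J \<longrightarrow> x \<epsilon> J)"

definition vl_maximal_ideal :: "'v ordered_field_sys \<Rightarrow> 'v vector_lattice_sys \<Rightarrow> 'v \<Rightarrow> bool" where
  "vl_maximal_ideal R X J \<longleftrightarrow>
     vl_ideal R X J \<and> J \<noteq> vcarrier X \<and>
     \<not> (\<exists>I. vl_ideal R X I \<and> I \<noteq> vcarrier X \<and> elts J \<subset> elts I)"

text \<open>The class of elements of the smallest ideal containing \<open>y\<close>.\<close>

definition principal_ideal :: "'v ordered_field_sys \<Rightarrow> 'v vector_lattice_sys \<Rightarrow> 'v \<Rightarrow> 'v set" where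
  "principal_ideal R X y =
     {x \<in> elts (vcarrier X). \<exists>r\<in>pos_reals R. vabs X x \<sqsubseteq>\<^bsub>vorder X\<^esub> r \<odot>\<^bsub>vmodule X\<^esub> y}"

definition strong_unit :: "'v ordered_field_sys \<Rightarrow> 'v vector_lattice_sys \<Rightarrow> 'v \<Rightarrow> bool" where
  "strong_unit R X y \<longleftrightarrow> y \<in> pos_cone X \<and> elts (vcarrier X) = principal_ideal R X y"

definition truncation :: "'v vector_lattice_sys \<Rightarrow> 'v \<Rightarrow> bool" where
  "truncation X t \<longleftrightarrow>
     is_fun t (pos_cone X) (pos_cone X) \<and>
     (\<forall>x\<in>pos_cone X. \<forall>y\<in>pos_cone X.
        app t x \<sqinter>\<^bsub>vorder X\<^esub> y = x \<sqinter>\<^bsub>vorder X\<^esub> app t y)"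

definition strong_truncation :: "'v ordered_field_sys \<Rightarrow> 'v vector_lattice_sys \<Rightarrow> 'v \<Rightarrow> bool" where
  "strong_truncation R X t \<longleftrightarrow>
     truncation X t \<and>
     (\<forall>x\<in>pos_cone X. \<exists>r\<in>pos_reals R.
        app t (r \<odot>\<^bsub>vmodule X\<^esub> x) = r \<odot>\<^bsub>vmodule X\<^esub> x)"

subsection \<open>The two statements\<close>

definition statement_T :: "'v ordered_field_sys \<Rightarrow> bool" where
  "statement_T R \<longleftrightarrow>
     (\<forall>X t. vector_lattice R X \<and> strong_truncation R X t \<longrightarrow> (\<exists>J. vl_maximal_ideal R X J))"

definition statement_U :: "'v ordered_field_sys \<Rightarrow> bool" where
  "statement_U R \<longleftrightarrow>
     (\<forall>X y. vector_lattice R X \<and> strong_unit R X y \<longrightarrow> (\<exists>J. vl_maximal_ideal R X J))"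

text \<open>
  The vector lattice \<open>{0}\<close> has a strong unit and a strong truncation but no proper ideal, so the two
  statements above, taken literally, both fail.  The versions below leave out degenerate instances:
  \<open>X = {0}\<close>, and the identity of \<open>X\<^sub>+\<close>, which is a strong truncation on every vector lattice, also
  on those without maximal ideals (such as the polynomials over the reals, ordered by their
  eventual behaviour at infinity).
\<close>

definition statement_T_nondegenerate :: "'v ordered_field_sys \<Rightarrow> bool" where
  "statement_T_nondegenerate R \<longleftrightarrow>
     (\<forall>X t. vector_lattice R X \<and> elts (vcarrier X) \<noteq> {vzero X} \<and>
        strong_truncation R X t \<and> (\<exists>x\<in>pos_cone X. app t x \<noteq> x) \<longrightarrow>
        (\<exists>J. vl_maximal_ideal R X J))"

definition statement_U_nondegenerate :: "'v ordered_field_sys \<Rightarrow> bool" where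
  "statement_U_nondegenerate R \<longleftrightarrow>
     (\<forall>X y. vector_lattice R X \<and> elts (vcarrier X) \<noteq> {vzero X} \<and> strong_unit R X y \<longrightarrow>
        (\<exists>J. vl_maximal_ideal R X J))"

end

end

theory Submission
  imports Defs
begin

text \<open>
  A strong unit \<open>u\<close> yields the strong truncation \<open>x \<mapsto> x \<sqinter> u\<close>, so the statement about truncations implies
  the statement about units, literally as well as without degenerate instances, since \<open>2u\<close> is moved by
  this truncation unless \<open>u = 0\<close>.

  Conversely, let \<open>x \<mapsto> x\<^sup>*\<close> be a strong truncation of \<open>X\<close> with \<open>a\<^sup>* \<noteq> a\<close> for some \<open>a \<ge> 0\<close>.  Adjoining a unit to
  \<open>X\<close> is of no use, because the maximal ideal obtained in this way could be \<open>X\<close> itself.  Instead \<open>X\<close> is made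
  smaller.  On functions, with truncation at the constant 1, one restricts to the closure of the set where
  \<open>a > 1\<close>; there \<open>a\<^sup>* = 1\<close> is a strong unit, as every function has a multiple bounded by 1.  Abstractly, this
  restriction is the quotient of \<open>X\<close> by the polar \<open>I\<close> of \<open>e = a - a\<^sup>*\<close>.  For \<open>x \<ge> 0\<close> there is \<open>r > 0\<close> such that
  \<open>w = r x\<close> satisfies \<open>w\<^sup>* = w\<close>, and then \<open>w - w \<sqinter> a\<^sup>*\<close> is disjoint from \<open>e\<close> (lemma
  \<open>fixed_point_excess_in_polar\<close>), that is, \<open>w \<le> a\<^sup>*\<close> modulo \<open>I\<close>.  So the class of \<open>a\<^sup>*\<close> is a strong unit of
  \<open>X/I\<close>, and \<open>X/I \<noteq> {0}\<close> because \<open>e \<notin> I\<close>.  A maximal ideal of \<open>X/I\<close> pulls back to one of \<open>X\<close> (lemma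
  \<open>ex_vl_maximal_ideal_if_quot\<close>).  For the literal statements the converse is vacuous: \<open>X/X = {0}\<close> has
  the strong unit 0 and no maximal ideal.

  Nothing in this argument uses choice, and the rest of the work is to carry it out inside a model of ZF.
  The algebra is done for arbitrary carriers.  The sets that it needs, namely the truncation by a unit, the
  polar, the quotient with its operations and order, and the ideals on both sides of the projection, are
  definable from the given data; explicit formulas show that they exist in the model.
\<close>

section \<open>Ideals of vector lattices\<close>

text \<open>
The scalars enter only through the set \<open>Pos\<close> of the positive ones and the closure properties of that
set, so that the order of the scalars and the order of the lattice never occur in the same formula.
The carrier is an arbitrary HOL set, which lets a vector lattice that lives in a model of ZF be treated
without reference to the model.
\<close>
locale vlattice = module R M + L: lattice L
  for R :: "('r, 'i) ring_scheme" (structure) and M :: "('r, 'v, 'j) module_scheme" (structure)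
    and L :: "('v, 'k) gorder_scheme" (structure) +
  fixes Pos :: "'r set"
  assumes carrier_L: "carrier L = carrier M"
    and add_right_mono:
      "\<lbrakk>x \<in> carrier M; y \<in> carrier M; z \<in> carrier M; x \<sqsubseteq>\<^bsub>L\<^esub> y\<rbrakk> \<Longrightarrow> x \<oplus>\<^bsub>M\<^esub> z \<sqsubseteq>\<^bsub>L\<^esub> y \<oplus>\<^bsub>M\<^esub> z"
    and smult_mono:
      "\<lbrakk>r \<in> Pos; x \<in> carrier M; y \<in> carrier M; x \<sqsubseteq>\<^bsub>L\<^esub> y\<rbrakk> \<Longrightarrow> r \<odot>\<^bsub>M\<^esub> x \<sqsubseteq>\<^bsub>L\<^esub> r \<odot>\<^bsub>M\<^esub> y"
    and Pos_carrier: "Pos \<subseteq> carrier R"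
    and Pos_one: "\<one>\<^bsub>R\<^esub> \<in> Pos"
    and Pos_add: "\<lbrakk>r \<in> Pos; s \<in> Pos\<rbrakk> \<Longrightarrow> r \<oplus>\<^bsub>R\<^esub> s \<in> Pos"
    and Pos_inv: "r \<in> Pos \<Longrightarrow> \<exists>s\<in>Pos. s \<otimes>\<^bsub>R\<^esub> r = \<one>\<^bsub>R\<^esub>"
    and Pos_cases: "r \<in> carrier R \<Longrightarrow> r \<in> Pos \<or> r = \<zero>\<^bsub>R\<^esub> \<or> \<ominus>\<^bsub>R\<^esub> r \<in> Pos"
begin

abbreviation V where "V \<equiv> carrier M"
abbreviation plus (infixl "\<^bold>+" 65) where "x \<^bold>+ y \<equiv> x \<oplus>\<^bsub>M\<^esub> y"
abbreviation neg ("\<^bold>-_" [81] 80) where "\<^bold>-x \<equiv> \<ominus>\<^bsub>M\<^esub> x"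
abbreviation nought ("\<^bold>0") where "\<^bold>0 \<equiv> \<zero>\<^bsub>M\<^esub>"
abbreviation scale (infixr "\<^bold>*" 70) where "r \<^bold>* x \<equiv> r \<odot>\<^bsub>M\<^esub> x"
abbreviation below (infix "\<preceq>" 50) where "x \<preceq> y \<equiv> x \<sqsubseteq>\<^bsub>L\<^esub> y"
abbreviation modulus ("\<^bold>|_\<^bold>|") where "\<^bold>|x\<^bold>| \<equiv> x \<squnion>\<^bsub>L\<^esub> \<^bold>-x"

lemma below_refl [simp]: "x \<in> V \<Longrightarrow> x \<preceq> x"
  by (simp add: carrier_L)

lemma below_trans:
  "\<lbrakk>x \<preceq> y; y \<preceq> z; x \<in> V; y \<in> V; z \<in> V\<rbrakk> \<Longrightarrow> x \<preceq> z"
  by (rule L.le_trans[unfolded carrier_L])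

lemma below_antisym: "\<lbrakk>x \<preceq> y; y \<preceq> x; x \<in> V; y \<in> V\<rbrakk> \<Longrightarrow> x = y"
  by (rule L.le_antisym[unfolded carrier_L])

lemma meet_in_carrier [simp]: "\<lbrakk>x \<in> V; y \<in> V\<rbrakk> \<Longrightarrow> x \<sqinter>\<^bsub>L\<^esub> y \<in> V"
  using L.meet_closed carrier_L by simp

lemma join_in_carrier [simp]: "\<lbrakk>x \<in> V; y \<in> V\<rbrakk> \<Longrightarrow> x \<squnion>\<^bsub>L\<^esub> y \<in> V"
  using L.join_closed carrier_L by simp

lemma meet_below1: "\<lbrakk>x \<in> V; y \<in> V\<rbrakk> \<Longrightarrow> x \<sqinter>\<^bsub>L\<^esub> y \<preceq> x"
  and meet_below2: "\<lbrakk>x \<in> V; y \<in> V\<rbrakk> \<Longrightarrow> x \<sqinter>\<^bsub>L\<^esub> y \<preceq> y"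
  and below_meet: "\<lbrakk>z \<preceq> x; z \<preceq> y; x \<in> V; y \<in> V; z \<in> V\<rbrakk> \<Longrightarrow> z \<preceq> x \<sqinter>\<^bsub>L\<^esub> y"
  by (rule L.meet_left[unfolded carrier_L] L.meet_right[unfolded carrier_L] L.meet_le[unfolded carrier_L]; assumption)+

lemma below_join1: "\<lbrakk>x \<in> V; y \<in> V\<rbrakk> \<Longrightarrow> x \<preceq> x \<squnion>\<^bsub>L\<^esub> y"
  and below_join2: "\<lbrakk>x \<in> V; y \<in> V\<rbrakk> \<Longrightarrow> y \<preceq> x \<squnion>\<^bsub>L\<^esub> y"
  and join_below: "\<lbrakk>x \<preceq> z; y \<preceq> z; x \<in> V; y \<in> V; z \<in> V\<rbrakk> \<Longrightarrow> x \<squnion>\<^bsub>L\<^esub> y \<preceq> z"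
  by (rule L.join_left[unfolded carrier_L] L.join_right[unfolded carrier_L] L.join_le[unfolded carrier_L]; assumption)+

lemma meet_absorb: "\<lbrakk>x \<in> V; y \<in> V; x \<preceq> y\<rbrakk> \<Longrightarrow> x \<sqinter>\<^bsub>L\<^esub> y = x"
  by (simp add: below_antisym below_meet meet_below1)

lemma add_mono:
  assumes "x \<preceq> y" "u \<preceq> v" and V: "x \<in> V" "y \<in> V" "u \<in> V" "v \<in> V"
  shows "x \<^bold>+ u \<preceq> y \<^bold>+ v"
proof -
  have "x \<^bold>+ u \<preceq> y \<^bold>+ u" using assms by (simp add: add_right_mono)
  moreover have "u \<^bold>+ y \<preceq> v \<^bold>+ y" using assms by (simp add: add_right_mono)
  ultimately show ?thesis using V below_trans[of "x \<^bold>+ u" "y \<^bold>+ u" "y \<^bold>+ v"] by (simp add: M.a_comm)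
qed

lemma add_right_cancel:
  assumes "x \<in> V" "y \<in> V" "z \<in> V"
  shows "x \<^bold>+ z \<preceq> y \<^bold>+ z \<longleftrightarrow> x \<preceq> y"
proof
  assume "x \<^bold>+ z \<preceq> y \<^bold>+ z"
  then have "x \<^bold>+ z \<^bold>+ \<^bold>-z \<preceq> y \<^bold>+ z \<^bold>+ \<^bold>-z"
    by (rule add_right_mono[rotated 3]) (use assms in auto)
  then show "x \<preceq> y" using assms by (simp add: M.a_assoc M.r_neg)
qed (use assms in \<open>simp add: add_right_mono\<close>)

lemma diff_below_iff:
  assumes "x \<in> V" "y \<in> V" "z \<in> V"
  shows "x \<^bold>+ \<^bold>-y \<preceq> z \<longleftrightarrow> x \<preceq> z \<^bold>+ y"
  using add_right_cancel[of "x \<^bold>+ \<^bold>-y" z y] assms by (simp add: M.a_assoc M.l_neg)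

lemma below_add_nonneg: "\<lbrakk>\<^bold>0 \<preceq> y; x \<in> V; y \<in> V\<rbrakk> \<Longrightarrow> x \<preceq> x \<^bold>+ y"
  using add_mono[of x x "\<^bold>0" y] by simp

lemma neg_zero [simp]: "\<^bold>-\<^bold>0 = \<^bold>0"
  using M.minus_equality[of "\<^bold>0" "\<^bold>0"] by simp

lemma neg_mono:
  assumes "x \<preceq> y" "x \<in> V" "y \<in> V"
  shows "\<^bold>-y \<preceq> \<^bold>-x"
proof -
  have "\<^bold>0 \<^bold>+ \<^bold>-y \<preceq> \<^bold>-x \<longleftrightarrow> \<^bold>0 \<preceq> \<^bold>-x \<^bold>+ y" using assms by (intro diff_below_iff) auto
  moreover have "x \<^bold>+ \<^bold>-x \<preceq> y \<^bold>+ \<^bold>-x" using assms by (simp add: add_right_mono)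
  ultimately show ?thesis using assms by (simp add: M.r_neg M.a_comm)
qed

lemma Pos_smult_closed [simp]: "\<lbrakk>r \<in> Pos; x \<in> V\<rbrakk> \<Longrightarrow> r \<^bold>* x \<in> V"
  using Pos_carrier by blast

lemma Pos_divide:
  assumes "r \<in> Pos"
  obtains s where "s \<in> Pos" "\<And>x. x \<in> V \<Longrightarrow> s \<^bold>* (r \<^bold>* x) = x"
proof -
  obtain s where s: "s \<in> Pos" "s \<otimes>\<^bsub>R\<^esub> r = \<one>\<^bsub>R\<^esub>" using Pos_inv assms by blast
  then have "s \<^bold>* (r \<^bold>* x) = x" if "x \<in> V" for x
    using that assms Pos_carrier smult_assoc1[of s r x, symmetric] by auto
  with s that show ?thesis by blast
qed

lemma below_zero_cancel:
  assumes "r \<in> Pos" "x \<in> V" "r \<^bold>* x \<preceq> \<^bold>0"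
  shows "x \<preceq> \<^bold>0"
proof -
  obtain s where s: "s \<in> Pos" "\<And>x. x \<in> V \<Longrightarrow> s \<^bold>* (r \<^bold>* x) = x" using Pos_divide assms by blast
  then have "s \<^bold>* (r \<^bold>* x) \<preceq> s \<^bold>* \<^bold>0" using assms by (intro smult_mono) auto
  then show ?thesis using s assms Pos_carrier by (auto simp: subset_iff)
qed

lemma add_self_eq: "x \<in> V \<Longrightarrow> x \<^bold>+ x = (\<one>\<^bsub>R\<^esub> \<oplus>\<^bsub>R\<^esub> \<one>\<^bsub>R\<^esub>) \<^bold>* x"
  by (simp add: smult_l_distr)

text \<open>
Half of a positive element is positive, because multiplication by the positive scalar 2 is an order
isomorphism.
\<close>
lemma nonneg_if_double_nonneg:
  assumes "x \<in> V" "\<^bold>0 \<preceq> x \<^bold>+ x"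
  shows "\<^bold>0 \<preceq> x"
proof -
  let ?two = "\<one>\<^bsub>R\<^esub> \<oplus>\<^bsub>R\<^esub> \<one>\<^bsub>R\<^esub>"
  have two: "?two \<in> Pos" by (simp add: Pos_add Pos_one)
  have "?two \<^bold>* \<^bold>-x = \<^bold>-(?two \<^bold>* x)" using assms by (simp add: smult_r_minus)
  also have "\<dots> \<preceq> \<^bold>0" using neg_mono[OF assms(2)] assms by (simp add: add_self_eq)
  finally have "\<^bold>-x \<preceq> \<^bold>0" using below_zero_cancel two assms by blast
  then show ?thesis using neg_mono[of "\<^bold>-x" "\<^bold>0"] assms by simp
qed

lemma modulus_closed: "x \<in> V \<Longrightarrow> \<^bold>|x\<^bold>| \<in> V"
  by simp

lemma below_modulus: "x \<in> V \<Longrightarrow> x \<preceq> \<^bold>|x\<^bold>|"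
  and neg_below_modulus: "x \<in> V \<Longrightarrow> \<^bold>-x \<preceq> \<^bold>|x\<^bold>|"
  by (simp_all add: below_join1 below_join2)

lemma modulus_below_iff:
  "\<lbrakk>x \<in> V; m \<in> V\<rbrakk> \<Longrightarrow> \<^bold>|x\<^bold>| \<preceq> m \<longleftrightarrow> x \<preceq> m \<and> \<^bold>-x \<preceq> m"
  by (meson below_trans below_modulus neg_below_modulus join_below modulus_closed M.a_inv_closed)

text \<open>
Adding \<open>x \<le> |x|\<close> and \<open>-x \<le> |x|\<close> gives \<open>0 \<le> 2 |x|\<close>.
\<close>
lemma modulus_nonneg:
  assumes "x \<in> V" shows "\<^bold>0 \<preceq> \<^bold>|x\<^bold>|"
proof (rule nonneg_if_double_nonneg)
  have "x \<^bold>+ \<^bold>-x \<preceq> \<^bold>|x\<^bold>| \<^bold>+ \<^bold>|x\<^bold>|"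
    using assms by (intro add_mono below_modulus neg_below_modulus) auto
  then show "\<^bold>0 \<preceq> \<^bold>|x\<^bold>| \<^bold>+ \<^bold>|x\<^bold>|" using assms by (simp add: M.r_neg)
qed (use assms in simp)

lemma modulus_of_nonneg:
  assumes "x \<in> V" "\<^bold>0 \<preceq> x" shows "\<^bold>|x\<^bold>| = x"
proof (rule below_antisym)
  have "\<^bold>-x \<preceq> \<^bold>0" using neg_mono[of "\<^bold>0" x] assms by simp
  then have "\<^bold>-x \<preceq> x" using assms below_trans[of "\<^bold>-x" "\<^bold>0" x] by simp
  then show "\<^bold>|x\<^bold>| \<preceq> x" using assms by (simp add: modulus_below_iff)
qed (use assms in \<open>auto intro: below_modulus\<close>)

text \<open>
Ideals are HOL subsets of the carrier here; which of them exist in a model is a separate question.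
\<close>
definition lattice_ideal :: "'v set \<Rightarrow> bool" where
  "lattice_ideal J \<longleftrightarrow> submodule J R M \<and> (\<forall>x\<in>V. \<forall>y\<in>V. \<^bold>|x\<^bold>| \<preceq> \<^bold>|y\<^bold>| \<and> y \<in> J \<longrightarrow> x \<in> J)"

lemma lattice_idealD:
  assumes "lattice_ideal J"
  shows "J \<subseteq> V" "\<^bold>0 \<in> J" "x \<in> J \<Longrightarrow> \<^bold>-x \<in> J" "\<lbrakk>x \<in> J; y \<in> J\<rbrakk> \<Longrightarrow> x \<^bold>+ y \<in> J"
    "\<lbrakk>r \<in> carrier R; x \<in> J\<rbrakk> \<Longrightarrow> r \<^bold>* x \<in> J"
proof -
  have sub: "submodule J R M" using assms by (simp add: lattice_ideal_def)
  note E = submoduleE[OF sub]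
  show "J \<subseteq> V" "x \<in> J \<Longrightarrow> \<^bold>-x \<in> J" "\<lbrakk>x \<in> J; y \<in> J\<rbrakk> \<Longrightarrow> x \<^bold>+ y \<in> J"
    "\<lbrakk>r \<in> carrier R; x \<in> J\<rbrakk> \<Longrightarrow> r \<^bold>* x \<in> J"
    using E by blast+
  obtain y where "y \<in> J" using E(2) by blast
  then have "y \<^bold>+ \<^bold>-y \<in> J" "y \<in> V" using E by blast+
  then show "\<^bold>0 \<in> J" by (simp add: M.r_neg)
qed

text \<open>
Bounding \<open>x\<close> and \<open>-x\<close> avoids computing the modulus of a concrete element.
\<close>
lemma lattice_ideal_solid:
  assumes "lattice_ideal J" "y \<in> J" "x \<in> V" "x \<preceq> y" "\<^bold>-x \<preceq> y"
  shows "x \<in> J"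
proof -
  have y: "y \<in> V" using assms lattice_idealD(1) by blast
  have "\<^bold>|x\<^bold>| \<preceq> y" using assms y by (simp add: modulus_below_iff)
  then have "\<^bold>|x\<^bold>| \<preceq> \<^bold>|y\<^bold>|" using below_trans[of "\<^bold>|x\<^bold>|" y "\<^bold>|y\<^bold>|"] assms y by (simp add: below_modulus)
  then show ?thesis using assms y unfolding lattice_ideal_def by blast
qed

lemma lattice_ideal_modulus_iff:
  assumes "lattice_ideal J" "x \<in> V"
  shows "\<^bold>|x\<^bold>| \<in> J \<longleftrightarrow> x \<in> J"
proof
  assume "\<^bold>|x\<^bold>| \<in> J"
  then show "x \<in> J" using lattice_ideal_solid[OF assms(1)] assms below_modulus neg_below_modulus by blast
next
  assume "x \<in> J"
  moreover have "\<^bold>|\<^bold>|x\<^bold>|\<^bold>| \<preceq> \<^bold>|x\<^bold>|" using assms by (simp add: modulus_of_nonneg modulus_nonneg)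
  ultimately show "\<^bold>|x\<^bold>| \<in> J" using assms unfolding lattice_ideal_def by (meson modulus_closed)
qed

text \<open>
Positive scalars suffice, since any other scalar is 0 or the negative of a positive one.
\<close>
lemma lattice_idealI:
  assumes "J \<subseteq> V" "\<^bold>0 \<in> J" "\<And>x. x \<in> J \<Longrightarrow> \<^bold>-x \<in> J" "\<And>x y. \<lbrakk>x \<in> J; y \<in> J\<rbrakk> \<Longrightarrow> x \<^bold>+ y \<in> J"
    and scale: "\<And>r x. \<lbrakk>r \<in> Pos; x \<in> J\<rbrakk> \<Longrightarrow> r \<^bold>* x \<in> J"
    and solid: "\<And>x y. \<lbrakk>x \<in> V; y \<in> J; \<^bold>|x\<^bold>| \<preceq> \<^bold>|y\<^bold>|\<rbrakk> \<Longrightarrow> x \<in> J"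
  shows "lattice_ideal J"
  unfolding lattice_ideal_def
proof (intro conjI ballI impI)
  show "submodule J R M"
  proof (rule submoduleI)
    fix r x assume rx: "r \<in> carrier R" "x \<in> J"
    then have x: "x \<in> V" using assms(1) by blast
    have "r \<^bold>* x \<in> J" if "\<ominus>\<^bsub>R\<^esub> r \<in> Pos"
    proof -
      have "\<^bold>-((\<ominus>\<^bsub>R\<^esub> r) \<^bold>* x) \<in> J" using that rx assms(3) scale by blast
      then show ?thesis using rx x by (simp add: smult_l_minus)
    qed
    then show "r \<^bold>* x \<in> J" using Pos_cases[OF rx(1)] rx x scale assms(2) by auto
  qed (use assms in auto)
qed (use solid in blast)

lemma lattice_ideal_carrier: "lattice_ideal V"
  by (rule lattice_idealI) auto

text \<open>
This is the polar \<open>{x. |x| \<sqinter> e = 0}\<close> of a positive \<open>e\<close>.  Replacing \<open>|x|\<close> by an upper bound \<open>m\<close> of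
\<open>x\<close> and \<open>-x\<close>, and the meet by its lower bounds, has two advantages: bounds of sums can be added without
appeal to distributivity, and the condition is visibly a first-order formula in the addition and the order.
\<close>
definition polar :: "'v \<Rightarrow> 'v set" where
  "polar e = {x \<in> V. \<exists>m\<in>V. \<^bold>0 \<preceq> m \<and> x \<preceq> m \<and> \<^bold>-x \<preceq> m \<and>
     (\<forall>c\<in>V. c \<preceq> m \<and> c \<preceq> e \<longrightarrow> c \<preceq> \<^bold>0)}"

lemma polarI:
  assumes "x \<in> V" "m \<in> V" "\<^bold>0 \<preceq> m" "x \<preceq> m" "\<^bold>-x \<preceq> m"
    and "\<And>c. \<lbrakk>c \<in> V; c \<preceq> m; c \<preceq> e\<rbrakk> \<Longrightarrow> c \<preceq> \<^bold>0"
  shows "x \<in> polar e"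
  unfolding polar_def using assms by blast

lemma polarE:
  assumes "x \<in> polar e"
  obtains m where "x \<in> V" "m \<in> V" "\<^bold>0 \<preceq> m" "x \<preceq> m" "\<^bold>-x \<preceq> m"
    "\<And>c. \<lbrakk>c \<in> V; c \<preceq> m; c \<preceq> e\<rbrakk> \<Longrightarrow> c \<preceq> \<^bold>0"
  using assms unfolding polar_def by blast

text \<open>
For sums: if \<open>c \<le> m + n\<close> and \<open>c \<le> e\<close>, then \<open>c - n\<close> lies below \<open>m\<close> and \<open>e\<close>, so \<open>c \<le> n\<close>, so \<open>c \<le> 0\<close>.
For multiples: if \<open>c \<le> r m\<close> and \<open>c \<le> e\<close>, then \<open>c/(r+1)\<close> lies below \<open>m\<close> and \<open>e\<close>; the summand 1 makes
the same divisor work for both bounds, whatever the size of \<open>r\<close>.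
\<close>
lemma lattice_ideal_polar:
  assumes e: "e \<in> V" "\<^bold>0 \<preceq> e"
  shows "lattice_ideal (polar e)"
proof (rule lattice_idealI)
  show "polar e \<subseteq> V" by (auto simp: polar_def)
  show "\<^bold>0 \<in> polar e" by (rule polarI[of _ "\<^bold>0"]) simp_all
next
  fix x assume "x \<in> polar e"
  then obtain m where "x \<in> V" "m \<in> V" "\<^bold>0 \<preceq> m" "x \<preceq> m" "\<^bold>-x \<preceq> m"
      "\<And>c. \<lbrakk>c \<in> V; c \<preceq> m; c \<preceq> e\<rbrakk> \<Longrightarrow> c \<preceq> \<^bold>0"
    by (elim polarE) blast
  then show "\<^bold>-x \<in> polar e" by (intro polarI[of _ m]) simp_all
next
  fix x y assume "x \<in> polar e" "y \<in> polar e"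
  then obtain m n where x: "x \<in> V" and y: "y \<in> V" and m: "m \<in> V" "\<^bold>0 \<preceq> m" "x \<preceq> m" "\<^bold>-x \<preceq> m"
      "\<And>c. \<lbrakk>c \<in> V; c \<preceq> m; c \<preceq> e\<rbrakk> \<Longrightarrow> c \<preceq> \<^bold>0"
    and n: "n \<in> V" "\<^bold>0 \<preceq> n" "y \<preceq> n" "\<^bold>-y \<preceq> n" "\<And>c. \<lbrakk>c \<in> V; c \<preceq> n; c \<preceq> e\<rbrakk> \<Longrightarrow> c \<preceq> \<^bold>0"
    by (elim polarE) blast
  have "\<^bold>0 \<preceq> m \<^bold>+ n" using add_mono[of "\<^bold>0" m "\<^bold>0" n] m n by simp
  moreover have "x \<^bold>+ y \<preceq> m \<^bold>+ n" using x y m n by (intro add_mono) auto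
  moreover have "\<^bold>-(x \<^bold>+ y) \<preceq> m \<^bold>+ n"
    using x y m n by (simp add: M.minus_add) (intro add_mono; simp)
  moreover have "c \<preceq> \<^bold>0" if c: "c \<in> V" "c \<preceq> m \<^bold>+ n" "c \<preceq> e" for c
  proof -
    have "c \<^bold>+ \<^bold>-n \<preceq> c" using diff_below_iff[of c n c] below_add_nonneg[of n c] c n by simp
    then have "c \<^bold>+ \<^bold>-n \<preceq> e" using below_trans[of "c \<^bold>+ \<^bold>-n" c e] c n e by simp
    then have "c \<^bold>+ \<^bold>-n \<preceq> \<^bold>0" using m(5)[of "c \<^bold>+ \<^bold>-n"] c n m by (simp add: diff_below_iff)
    then have "c \<preceq> n" using c n by (simp add: diff_below_iff)
    then show ?thesis using n c by blast
  qed
  ultimately show "x \<^bold>+ y \<in> polar e" using x y m(1) n(1) by (intro polarI[of _ "m \<^bold>+ n"]) simp_all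
next
  fix r x assume r: "r \<in> Pos" and "x \<in> polar e"
  then obtain m where x: "x \<in> V" and m: "m \<in> V" "\<^bold>0 \<preceq> m" "x \<preceq> m" "\<^bold>-x \<preceq> m"
      "\<And>c. \<lbrakk>c \<in> V; c \<preceq> m; c \<preceq> e\<rbrakk> \<Longrightarrow> c \<preceq> \<^bold>0"
    by (elim polarE) blast
  have rR: "r \<in> carrier R" using r Pos_carrier by blast
  have "r \<^bold>* x \<preceq> r \<^bold>* m" "r \<^bold>* \<^bold>0 \<preceq> r \<^bold>* m" "r \<^bold>* \<^bold>-x \<preceq> r \<^bold>* m"
    using smult_mono r x m by auto
  then have "r \<^bold>* x \<preceq> r \<^bold>* m" "\<^bold>0 \<preceq> r \<^bold>* m" "\<^bold>-(r \<^bold>* x) \<preceq> r \<^bold>* m"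
    using x rR by (auto simp: smult_r_minus)
  moreover have "c \<preceq> \<^bold>0" if c: "c \<in> V" "c \<preceq> r \<^bold>* m" "c \<preceq> e" for c
  proof -
    let ?q = "r \<oplus>\<^bsub>R\<^esub> \<one>\<^bsub>R\<^esub>"
    have q: "?q \<in> Pos" using r by (simp add: Pos_add Pos_one)
    have enlarge: "r \<^bold>* z \<preceq> ?q \<^bold>* z" "z \<preceq> ?q \<^bold>* z" if z: "z \<in> V" "\<^bold>0 \<preceq> z" for z
    proof -
      have "?q \<^bold>* z = r \<^bold>* z \<^bold>+ z" using z rR by (simp add: smult_l_distr)
      moreover have "\<^bold>0 \<preceq> r \<^bold>* z" using smult_mono[of r "\<^bold>0" z] r rR z by simp
      ultimately show "r \<^bold>* z \<preceq> ?q \<^bold>* z" "z \<preceq> ?q \<^bold>* z"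
        using below_add_nonneg[of z "r \<^bold>* z"] below_add_nonneg[of "r \<^bold>* z" z] z rR
        by (simp_all add: M.a_comm)
    qed
    obtain s where s: "s \<in> Pos" "\<And>x. x \<in> V \<Longrightarrow> s \<^bold>* (?q \<^bold>* x) = x" using Pos_divide q by blast
    have "c \<preceq> ?q \<^bold>* m" using below_trans[OF c(2) enlarge(1)[OF m(1,2)]] c m r q by simp
    then have cm: "s \<^bold>* c \<preceq> m" using smult_mono[of s c "?q \<^bold>* m"] s c m q by simp
    have "c \<preceq> ?q \<^bold>* e" using below_trans[OF c(3) enlarge(2)[OF e]] c e q by simp
    then have "s \<^bold>* c \<preceq> e" using smult_mono[of s c "?q \<^bold>* e"] s c e q by simp
    then have "s \<^bold>* c \<preceq> \<^bold>0" using m(5) cm s c by simp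
    then show ?thesis using below_zero_cancel s c by blast
  qed
  ultimately show "r \<^bold>* x \<in> polar e"
    using x m(1) rR by (intro polarI[of _ "r \<^bold>* m"]) simp_all
next
  fix x y assume x: "x \<in> V" and "y \<in> polar e" and xy: "\<^bold>|x\<^bold>| \<preceq> \<^bold>|y\<^bold>|"
  then obtain m where y: "y \<in> V" and m: "m \<in> V" "\<^bold>0 \<preceq> m" "y \<preceq> m" "\<^bold>-y \<preceq> m"
      "\<And>c. \<lbrakk>c \<in> V; c \<preceq> m; c \<preceq> e\<rbrakk> \<Longrightarrow> c \<preceq> \<^bold>0"
    by (elim polarE) blast
  have "\<^bold>|y\<^bold>| \<preceq> m" using y m by (simp add: modulus_below_iff)
  then have "\<^bold>|x\<^bold>| \<preceq> m" using below_trans[OF xy] x y m by simp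
  then have "x \<preceq> m" "\<^bold>-x \<preceq> m" using x m by (simp_all add: modulus_below_iff)
  then show "x \<in> polar e" using polarI x m by blast
qed

lemma self_in_polar_iff:
  assumes e: "e \<in> V" "\<^bold>0 \<preceq> e"
  shows "e \<in> polar e \<longleftrightarrow> e = \<^bold>0"
proof
  assume "e \<in> polar e"
  then obtain m where "e \<preceq> m" "\<And>c. \<lbrakk>c \<in> V; c \<preceq> m; c \<preceq> e\<rbrakk> \<Longrightarrow> c \<preceq> \<^bold>0"
    by (elim polarE) blast
  then have "e \<preceq> \<^bold>0" using e by simp
  then show "e = \<^bold>0" using below_antisym e by blast
qed (use lattice_idealD(2)[OF lattice_ideal_polar[OF e]] in simp)

text \<open>
For a truncation, \<open>t\<close> is the value at \<open>a\<close> and \<open>w\<close> is a fixed point.  Thinking of truncation as \<open>f \<mapsto> f \<sqinter> 1\<close>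
on functions, \<open>w \<le> 1\<close>, and at the points where \<open>a > 1\<close> the value of \<open>t\<close> is 1, so \<open>w\<close> exceeds \<open>t\<close> only
where \<open>a - t\<close> vanishes.  Abstractly, if \<open>c\<close> is below \<open>w - w \<sqinter> t\<close> and \<open>a - t\<close>, then \<open>c + w \<sqinter> t\<close> is below
\<open>w\<close> and \<open>a\<close>, hence below \<open>w \<sqinter> a = w \<sqinter> t\<close>.
\<close>
lemma fixed_point_excess_in_polar:
  assumes V: "w \<in> V" "a \<in> V" "t \<in> V" and "t \<preceq> a" and eq: "w \<sqinter>\<^bsub>L\<^esub> a = w \<sqinter>\<^bsub>L\<^esub> t"
  shows "w \<^bold>+ \<^bold>-(w \<sqinter>\<^bsub>L\<^esub> t) \<in> polar (a \<^bold>+ \<^bold>-t)"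
proof -
  define v where "v = w \<sqinter>\<^bsub>L\<^esub> t"
  have v: "v \<in> V" "v \<preceq> w" "v \<preceq> t" using V by (auto simp: v_def meet_below1 meet_below2)
  define i where "i = w \<^bold>+ \<^bold>-v"
  have i: "i \<in> V" "w = i \<^bold>+ v" using V v by (auto simp: i_def M.a_assoc M.l_neg)
  have i0: "\<^bold>0 \<preceq> i" using add_right_cancel[of "\<^bold>0" i v] v i by simp
  have "\<^bold>-i \<preceq> \<^bold>0" using neg_mono[OF i0] i by simp
  then have "\<^bold>-i \<preceq> i" using below_trans[OF _ i0] i by simp
  moreover have "c \<preceq> \<^bold>0" if c: "c \<in> V" "c \<preceq> i" "c \<preceq> a \<^bold>+ \<^bold>-t" for c
  proof -
    have "c \<^bold>+ v \<preceq> w" using add_right_mono[of c i v] c i v by simp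
    moreover have "c \<^bold>+ v \<preceq> a \<^bold>+ \<^bold>-t \<^bold>+ t" using c v V by (intro add_mono) auto
    then have "c \<^bold>+ v \<preceq> a" using V by (simp add: M.a_assoc M.l_neg)
    ultimately have "c \<^bold>+ v \<preceq> w \<sqinter>\<^bsub>L\<^esub> a" using c v V by (intro below_meet) auto
    then have "c \<^bold>+ v \<preceq> \<^bold>0 \<^bold>+ v" using eq v by (simp add: v_def)
    then show ?thesis using c v by (simp add: add_right_cancel del: M.l_zero)
  qed
  ultimately have "i \<in> polar (a \<^bold>+ \<^bold>-t)" using i i0 by (intro polarI[of _ i]) simp_all
  then show ?thesis by (simp add: i_def v_def)
qed

end

section \<open>Quotients by ideals\<close>

text \<open>
The order of the quotient is described by \<open>x \<le> y + i\<close> for some \<open>i\<close> in the ideal rather than by positive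
parts.  Transitivity and compatibility with the operations are then immediate, and joins and meets are
found by absorbing two such errors \<open>i\<close> and \<open>j\<close> into the single error \<open>i + j\<close>.
\<close>
locale vlattice_quotient = vlattice R M L Pos
  for R :: "('r, 'i) ring_scheme" (structure) and M :: "('r, 'v, 'j) module_scheme" (structure)
    and L :: "('v, 'k) gorder_scheme" (structure) and Pos +
  fixes J :: "'v set" and M' :: "('r, 'w, 'l) module_scheme" and L' :: "('w, 'm) gorder_scheme"
    and proj :: "'v \<Rightarrow> 'w"
  assumes J: "lattice_ideal J"
    and carrier_M': "carrier M' = proj ` V"
    and proj_eq_iff: "\<lbrakk>x \<in> V; y \<in> V\<rbrakk> \<Longrightarrow> proj x = proj y \<longleftrightarrow> x \<^bold>+ \<^bold>-y \<in> J"
    and proj_add: "\<lbrakk>x \<in> V; y \<in> V\<rbrakk> \<Longrightarrow> proj x \<oplus>\<^bsub>M'\<^esub> proj y = proj (x \<^bold>+ y)"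
    and proj_smult: "\<lbrakk>r \<in> carrier R; x \<in> V\<rbrakk> \<Longrightarrow> r \<odot>\<^bsub>M'\<^esub> proj x = proj (r \<^bold>* x)"
    and proj_zero: "\<zero>\<^bsub>M'\<^esub> = proj \<^bold>0"
    and carrier_L': "carrier L' = proj ` V"
    and eq_L': "eq L' = (=)"
    and proj_below_iff:
      "\<lbrakk>x \<in> V; y \<in> V\<rbrakk> \<Longrightarrow> proj x \<sqsubseteq>\<^bsub>L'\<^esub> proj y \<longleftrightarrow> (\<exists>i\<in>J. x \<preceq> y \<^bold>+ i)"
begin

lemma J_carrier: "i \<in> J \<Longrightarrow> i \<in> V"
  using lattice_idealD(1)[OF J] by blast

lemma modulus_J: "i \<in> J \<Longrightarrow> \<^bold>|i\<^bold>| \<in> J"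
  by (simp add: lattice_ideal_modulus_iff[OF J] J_carrier)

lemma J_add: "\<lbrakk>i \<in> J; j \<in> J\<rbrakk> \<Longrightarrow> i \<^bold>+ j \<in> J"
  by (rule lattice_idealD(4)[OF J])

lemma proj_belowI: "\<lbrakk>x \<in> V; y \<in> V; i \<in> J; x \<preceq> y \<^bold>+ i\<rbrakk> \<Longrightarrow> proj x \<sqsubseteq>\<^bsub>L'\<^esub> proj y"
  unfolding proj_below_iff by blast

text \<open>
The error can be taken positive, because \<open>|i|\<close> is as good as \<open>i\<close>.
\<close>
lemma proj_belowE:
  assumes "x \<in> V" "y \<in> V" "proj x \<sqsubseteq>\<^bsub>L'\<^esub> proj y"
  obtains i where "i \<in> J" "\<^bold>0 \<preceq> i" "x \<preceq> y \<^bold>+ i"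
proof -
  obtain i where i: "i \<in> J" "x \<preceq> y \<^bold>+ i"
    using assms(3) unfolding proj_below_iff[OF assms(1,2)] by blast
  then have iV: "i \<in> V" by (simp add: J_carrier)
  have "y \<^bold>+ i \<preceq> y \<^bold>+ \<^bold>|i\<^bold>|" using assms iV by (intro add_mono) (auto intro: below_modulus)
  then have "x \<preceq> y \<^bold>+ \<^bold>|i\<^bold>|" using below_trans[OF i(2)] assms iV by simp
  then show thesis using that i modulus_J iV modulus_nonneg by blast
qed

lemma proj_mono: "\<lbrakk>x \<in> V; y \<in> V; x \<preceq> y\<rbrakk> \<Longrightarrow> proj x \<sqsubseteq>\<^bsub>L'\<^esub> proj y"
  by (rule proj_belowI[of _ _ "\<^bold>0"]) (simp_all add: lattice_idealD(2)[OF J])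

lemma module_M': "module R M'"
proof (rule moduleI)
  show "cring R" by (rule R.cring_axioms)
  show "abelian_group M'"
  proof (rule abelian_groupI)
    fix p assume "p \<in> carrier M'"
    then obtain x where "x \<in> V" "p = proj x" by (auto simp: carrier_M')
    then show "\<exists>q\<in>carrier M'. q \<oplus>\<^bsub>M'\<^esub> p = \<zero>\<^bsub>M'\<^esub>"
      by (auto simp: carrier_M' proj_add proj_zero M.l_neg intro!: bexI[of _ "\<^bold>-x"])
  qed (auto simp: carrier_M' proj_add proj_zero M.a_ac)
qed (auto simp: carrier_M' proj_add proj_smult smult_l_distr smult_r_distr smult_assoc1)

lemma partial_order_L': "partial_order L'"
proof
  show "(.=\<^bsub>L'\<^esub>) = (=)" by (rule eq_L')
next
  fix p assume "p \<in> carrier L'"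
  then obtain x where "x \<in> V" "p = proj x" unfolding carrier_L' by blast
  then show "p \<sqsubseteq>\<^bsub>L'\<^esub> p" by (simp add: proj_mono)
next
  fix p q assume pq: "p \<sqsubseteq>\<^bsub>L'\<^esub> q" "q \<sqsubseteq>\<^bsub>L'\<^esub> p" "p \<in> carrier L'" "q \<in> carrier L'"
  then obtain x y where x: "x \<in> V" "p = proj x" and y: "y \<in> V" "q = proj y"
    by (auto simp: carrier_L')
  obtain i where i: "i \<in> J" "\<^bold>0 \<preceq> i" "x \<preceq> y \<^bold>+ i"
    by (rule proj_belowE[of x y]) (use pq x y  in simp_all)
  obtain j where j: "j \<in> J" "\<^bold>0 \<preceq> j" "y \<preceq> x \<^bold>+ j"
    by (rule proj_belowE[of y x]) (use pq x y  in simp_all)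
  have V: "i \<in> V" "j \<in> V" using i j J_carrier by auto
  have d: "x \<^bold>+ \<^bold>-y \<preceq> i" using x y i V by (simp add: diff_below_iff M.a_comm)
  have "y \<^bold>+ \<^bold>-x \<preceq> j" using x y j V by (simp add: diff_below_iff M.a_comm)
  then have d': "\<^bold>-(x \<^bold>+ \<^bold>-y) \<preceq> j" using x y by (simp add: M.minus_add M.a_comm)
  have ij: "i \<preceq> i \<^bold>+ j" "j \<preceq> i \<^bold>+ j"
    using below_add_nonneg[of j i] below_add_nonneg[of i j] i j V by (simp_all add: M.a_comm)
  have "x \<^bold>+ \<^bold>-y \<preceq> i \<^bold>+ j" by (rule below_trans[OF d ij(1)]) (use x y V in simp_all)
  moreover have "\<^bold>-(x \<^bold>+ \<^bold>-y) \<preceq> i \<^bold>+ j" by (rule below_trans[OF d' ij(2)]) (use x y V in simp_all)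
  moreover have "i \<^bold>+ j \<in> J" using i(1) j(1) by (rule J_add)
  ultimately have "x \<^bold>+ \<^bold>-y \<in> J"
    using x(1) y(1) by (intro lattice_ideal_solid[OF J, of "i \<^bold>+ j" "x \<^bold>+ \<^bold>-y"]) simp_all
  then show "p .=\<^bsub>L'\<^esub> q" using x y by (simp add: eq_L' proj_eq_iff)
next
  fix p q s assume pqs: "p \<sqsubseteq>\<^bsub>L'\<^esub> q" "q \<sqsubseteq>\<^bsub>L'\<^esub> s" "p \<in> carrier L'" "q \<in> carrier L'" "s \<in> carrier L'"
  then obtain x y z where V: "x \<in> V" "y \<in> V" "z \<in> V" and eq: "p = proj x" "q = proj y" "s = proj z"
    by (auto simp: carrier_L')
  obtain i where i: "i \<in> J" "\<^bold>0 \<preceq> i" "x \<preceq> y \<^bold>+ i"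
      by (rule proj_belowE[of x y]) (use pqs V eq in simp_all)
  obtain j where j: "j \<in> J" "\<^bold>0 \<preceq> j" "y \<preceq> z \<^bold>+ j"
      by (rule proj_belowE[of y z]) (use pqs V eq in simp_all)
  have W: "i \<in> V" "j \<in> V" using i j J_carrier by auto
  have le: "y \<^bold>+ i \<preceq> z \<^bold>+ j \<^bold>+ i" using j V W by (simp add: add_right_mono)
  have "x \<preceq> z \<^bold>+ j \<^bold>+ i" by (rule below_trans[OF i(3) le]) (use V W in simp_all)
  then have "x \<preceq> z \<^bold>+ (j \<^bold>+ i)" using V W by (simp add: M.a_assoc)
  then show "p \<sqsubseteq>\<^bsub>L'\<^esub> s" unfolding eq using i j V by (intro proj_belowI[of x z "j \<^bold>+ i"] J_add)
qed (simp_all add: eq_L')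

lemma join_proj_least:
  assumes "x \<in> V" "y \<in> V"
  shows "least L' (proj (x \<squnion>\<^bsub>L\<^esub> y)) (Upper L' {proj x, proj y})"
proof -
  interpret Q: partial_order L' by (rule partial_order_L')
  have "proj (x \<squnion>\<^bsub>L\<^esub> y) \<sqsubseteq>\<^bsub>L'\<^esub> proj z"
    if z: "z \<in> V" and le: "proj x \<sqsubseteq>\<^bsub>L'\<^esub> proj z" "proj y \<sqsubseteq>\<^bsub>L'\<^esub> proj z" for z
  proof -
    obtain i where i: "i \<in> J" "\<^bold>0 \<preceq> i" "x \<preceq> z \<^bold>+ i" 
      by (rule proj_belowE[of x z]) (use le z assms in simp_all)
    obtain j where j: "j \<in> J" "\<^bold>0 \<preceq> j" "y \<preceq> z \<^bold>+ j" 
      by (rule proj_belowE[of y z]) (use le z assms in simp_all)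
    have V: "i \<in> V" "j \<in> V" using i j J_carrier by auto
    have le': "z \<^bold>+ i \<preceq> z \<^bold>+ (i \<^bold>+ j)" "z \<^bold>+ j \<preceq> z \<^bold>+ (i \<^bold>+ j)"
      using below_add_nonneg[of j "z \<^bold>+ i"] below_add_nonneg[of i "z \<^bold>+ j"] i j V z
      by (simp_all add: M.a_ac)
    have "x \<preceq> z \<^bold>+ (i \<^bold>+ j)" by (rule below_trans[OF i(3) le'(1)]) (use assms z V in simp_all)
    moreover have "y \<preceq> z \<^bold>+ (i \<^bold>+ j)" by (rule below_trans[OF j(3) le'(2)]) (use assms z V in simp_all)
    ultimately have "x \<squnion>\<^bsub>L\<^esub> y \<preceq> z \<^bold>+ (i \<^bold>+ j)" using assms z V by (simp add: join_below)
    then show ?thesis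
      using i j assms z by (intro proj_belowI[of _ z "i \<^bold>+ j"] J_add) simp_all
  qed
  then show ?thesis
    using assms
    by (intro least_UpperI) (auto simp: carrier_L' Upper_def below_join1 below_join2 intro: proj_mono)
qed

lemma meet_proj_greatest:
  assumes "x \<in> V" "y \<in> V"
  shows "greatest L' (proj (x \<sqinter>\<^bsub>L\<^esub> y)) (Lower L' {proj x, proj y})"
proof -
  interpret Q: partial_order L' by (rule partial_order_L')
  have "proj z \<sqsubseteq>\<^bsub>L'\<^esub> proj (x \<sqinter>\<^bsub>L\<^esub> y)"
    if z: "z \<in> V" and le: "proj z \<sqsubseteq>\<^bsub>L'\<^esub> proj x" "proj z \<sqsubseteq>\<^bsub>L'\<^esub> proj y" for z
  proof -
    obtain i where i: "i \<in> J" "\<^bold>0 \<preceq> i" "z \<preceq> x \<^bold>+ i" 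
      by (rule proj_belowE[of z x]) (use le z assms in simp_all)
    obtain j where j: "j \<in> J" "\<^bold>0 \<preceq> j" "z \<preceq> y \<^bold>+ j" 
      by (rule proj_belowE[of z y]) (use le z assms in simp_all)
    have V: "i \<in> V" "j \<in> V" using i j J_carrier by auto
    have le': "x \<^bold>+ i \<preceq> x \<^bold>+ (i \<^bold>+ j)" "y \<^bold>+ j \<preceq> y \<^bold>+ (i \<^bold>+ j)"
      using below_add_nonneg[of j "x \<^bold>+ i"] below_add_nonneg[of i "y \<^bold>+ j"] i j V assms
      by (simp_all add: M.a_ac)
    have "z \<preceq> x \<^bold>+ (i \<^bold>+ j)" by (rule below_trans[OF i(3) le'(1)]) (use assms z V in simp_all)
    moreover have "z \<preceq> y \<^bold>+ (i \<^bold>+ j)" by (rule below_trans[OF j(3) le'(2)]) (use assms z V in simp_all)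
    ultimately have "z \<^bold>+ \<^bold>-(i \<^bold>+ j) \<preceq> x \<sqinter>\<^bsub>L\<^esub> y"
      using assms z V by (intro below_meet) (simp_all add: diff_below_iff del: M.minus_add)
    then have "z \<preceq> (x \<sqinter>\<^bsub>L\<^esub> y) \<^bold>+ (i \<^bold>+ j)" using assms z V by (simp add: diff_below_iff)
    then show ?thesis
      using i j assms z by (intro proj_belowI[of z _ "i \<^bold>+ j"] J_add) simp_all
  qed
  then show ?thesis
    using assms
    by (intro greatest_LowerI) (auto simp: carrier_L' Lower_def meet_below1 meet_below2 intro: proj_mono)
qed

sublocale Q: vlattice R M' L' Pos
proof (intro vlattice.intro vlattice_axioms.intro)
  show "module R M'" by (rule module_M')
  show "lattice L'"
  proof (intro lattice.intro upper_semilattice.intro lower_semilattice.intro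
      upper_semilattice_axioms.intro lower_semilattice_axioms.intro partial_order_L')
    fix p q assume "p \<in> carrier L'" "q \<in> carrier L'"
    then show "\<exists>s. least L' s (Upper L' {p, q})" "\<exists>s. greatest L' s (Lower L' {p, q})"
      by (auto simp: carrier_L' intro: join_proj_least meet_proj_greatest)
  qed
  show "carrier L' = carrier M'" by (simp add: carrier_L' carrier_M')
  show "p \<oplus>\<^bsub>M'\<^esub> s \<sqsubseteq>\<^bsub>L'\<^esub> q \<oplus>\<^bsub>M'\<^esub> s"
    if pqs: "p \<in> carrier M'" "q \<in> carrier M'" "s \<in> carrier M'" "p \<sqsubseteq>\<^bsub>L'\<^esub> q" for p q s
  proof -
    obtain x y z where V: "x \<in> V" "y \<in> V" "z \<in> V" and eq: "p = proj x" "q = proj y" "s = proj z"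
      using pqs by (auto simp: carrier_M')
    obtain i where i: "i \<in> J" "\<^bold>0 \<preceq> i" "x \<preceq> y \<^bold>+ i"
      by (rule proj_belowE[of x y]) (use pqs V eq in simp_all)
    have iV: "i \<in> V" using i J_carrier by simp
    have "x \<^bold>+ z \<preceq> y \<^bold>+ i \<^bold>+ z" using V i iV by (simp add: add_right_mono)
    then have "x \<^bold>+ z \<preceq> y \<^bold>+ z \<^bold>+ i" using V iV by (simp add: M.a_ac)
    then have "proj (x \<^bold>+ z) \<sqsubseteq>\<^bsub>L'\<^esub> proj (y \<^bold>+ z)" using V i by (intro proj_belowI[of _ _ i]) simp_all
    then show ?thesis using V by (simp add: eq proj_add)
  qed
  show "r \<odot>\<^bsub>M'\<^esub> p \<sqsubseteq>\<^bsub>L'\<^esub> r \<odot>\<^bsub>M'\<^esub> q"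
    if r: "r \<in> Pos" and pq: "p \<in> carrier M'" "q \<in> carrier M'" "p \<sqsubseteq>\<^bsub>L'\<^esub> q" for r p q
  proof -
    obtain x y where V: "x \<in> V" "y \<in> V" and eq: "p = proj x" "q = proj y"
      using pq by (auto simp: carrier_M')
    obtain i where i: "i \<in> J" "\<^bold>0 \<preceq> i" "x \<preceq> y \<^bold>+ i"
      by (rule proj_belowE[of x y]) (use pq V eq in simp_all)
    have iV: "i \<in> V" using i J_carrier by simp
    have rR: "r \<in> carrier R" using r Pos_carrier by blast
    have "r \<^bold>* x \<preceq> r \<^bold>* (y \<^bold>+ i)" using V i iV r by (simp add: smult_mono)
    then have "r \<^bold>* x \<preceq> r \<^bold>* y \<^bold>+ r \<^bold>* i" using V iV rR by (simp add: smult_r_distr)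
    then have "proj (r \<^bold>* x) \<sqsubseteq>\<^bsub>L'\<^esub> proj (r \<^bold>* y)"
      using V rR lattice_idealD(5)[OF J rR i(1)] by (intro proj_belowI[of _ _ "r \<^bold>* i"]) simp_all
    then show ?thesis using V rR by (simp add: eq proj_smult)
  qed
qed (fact Pos_carrier Pos_one Pos_add Pos_inv Pos_cases)+

lemma proj_closed [simp]: "x \<in> V \<Longrightarrow> proj x \<in> carrier M'"
  by (simp add: carrier_M')

lemma proj_neg: "x \<in> V \<Longrightarrow> \<ominus>\<^bsub>M'\<^esub> proj x = proj (\<^bold>-x)"
  by (rule Q.M.minus_equality) (simp_all add: proj_add proj_zero M.l_neg)

lemma proj_join: "\<lbrakk>x \<in> V; y \<in> V\<rbrakk> \<Longrightarrow> proj x \<squnion>\<^bsub>L'\<^esub> proj y = proj (x \<squnion>\<^bsub>L\<^esub> y)"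
  unfolding join_def[of L'] sup_def[of L']
  by (rule some_equality) (blast intro: join_proj_least Q.L.least_unique)+

lemma proj_modulus: "x \<in> V \<Longrightarrow> Q.modulus (proj x) = proj \<^bold>|x\<^bold>|"
  by (simp add: proj_neg proj_join)

lemma lattice_ideal_preimage:
  assumes "Q.lattice_ideal N"
  shows "lattice_ideal {x \<in> V. proj x \<in> N}"
proof (rule lattice_idealI)
  fix x y assume x: "x \<in> V" and "y \<in> {x \<in> V. proj x \<in> N}" and le: "\<^bold>|x\<^bold>| \<preceq> \<^bold>|y\<^bold>|"
  then have y: "y \<in> V" "proj y \<in> N" by auto
  have "Q.modulus (proj x) \<sqsubseteq>\<^bsub>L'\<^esub> Q.modulus (proj y)"
    using proj_mono[OF _ _ le] x y by (simp add: proj_modulus)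
  then have "proj x \<in> N" using assms x y unfolding Q.lattice_ideal_def by (meson proj_closed)
  then show "x \<in> {x \<in> V. proj x \<in> N}" using x by simp
next
  fix r x assume r: "r \<in> Pos" and "x \<in> {x \<in> V. proj x \<in> N}"
  then have x: "x \<in> V" "proj x \<in> N" by auto
  have rR: "r \<in> carrier R" using r Pos_carrier by blast
  have "proj (r \<^bold>* x) \<in> N" using Q.lattice_idealD(5)[OF assms rR x(2)] rR x by (simp add: proj_smult)
  then show "r \<^bold>* x \<in> {x \<in> V. proj x \<in> N}" using rR x by simp
next
  show "\<^bold>0 \<in> {x \<in> V. proj x \<in> N}" using Q.lattice_idealD(2)[OF assms] by (simp add: proj_zero)
next
  fix x y assume "x \<in> {x \<in> V. proj x \<in> N}" "y \<in> {x \<in> V. proj x \<in> N}"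
  then show "x \<^bold>+ y \<in> {x \<in> V. proj x \<in> N}" using Q.lattice_idealD(4)[OF assms] by (auto simp: proj_add[symmetric])
next
  fix x assume "x \<in> {x \<in> V. proj x \<in> N}"
  then show "\<^bold>-x \<in> {x \<in> V. proj x \<in> N}" using Q.lattice_idealD(3)[OF assms] by (auto simp: proj_neg[symmetric])
qed auto

text \<open>
An ideal that contains the kernel is saturated: it is the preimage of its image.
\<close>
lemma mem_if_proj_mem:
  assumes I: "lattice_ideal I" "J \<subseteq> I" and x: "x \<in> V" and mem: "proj x \<in> proj ` I"
  shows "x \<in> I"
proof -
  obtain i where i: "i \<in> I" "proj x = proj i" using mem by blast
  then have iV: "i \<in> V" using lattice_idealD(1)[OF I(1)] by blast
  then have "x \<^bold>+ \<^bold>-i \<in> I" using proj_eq_iff[OF x iV] i(2) I(2) by auto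
  then have "x \<^bold>+ \<^bold>-i \<^bold>+ i \<in> I" using lattice_idealD(4)[OF I(1)] i by blast
  then show ?thesis using x iV by (simp add: M.a_assoc M.l_neg)
qed

text \<open>
Solidity is the point: \<open>|x| + J \<le> |y| + J\<close> with \<open>y\<close> in \<open>I\<close> means \<open>|x| \<le> |y| + i\<close> with \<open>i\<close> in \<open>J\<close>, and the right
side lies in \<open>I\<close> because \<open>I\<close> contains \<open>J\<close>.
\<close>
lemma lattice_ideal_image:
  assumes I: "lattice_ideal I" "J \<subseteq> I"
  shows "Q.lattice_ideal (proj ` I)"
proof (rule Q.lattice_idealI)
  note D = lattice_idealD[OF I(1)]
  show "proj ` I \<subseteq> carrier M'" using D(1) by auto
  show "\<zero>\<^bsub>M'\<^esub> \<in> proj ` I" using D(2) by (simp add: proj_zero)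
  show "\<ominus>\<^bsub>M'\<^esub> p \<in> proj ` I" if "p \<in> proj ` I" for p
  proof -
    obtain x where x: "x \<in> I" "p = proj x" using \<open>p \<in> proj ` I\<close> by blast
    then show ?thesis using D(1) D(3)[OF x(1)] by (auto simp: proj_neg)
  qed
  show "p \<oplus>\<^bsub>M'\<^esub> q \<in> proj ` I" if "p \<in> proj ` I" "q \<in> proj ` I" for p q
  proof -
    obtain x y where xy: "x \<in> I" "p = proj x" "y \<in> I" "q = proj y" using \<open>p \<in> proj ` I\<close> \<open>q \<in> proj ` I\<close> by blast
    then have "x \<in> V" "y \<in> V" using D(1) by auto
    then show ?thesis using D(4)[OF xy(1,3)] xy by (simp add: proj_add)
  qed
  show "r \<odot>\<^bsub>M'\<^esub> p \<in> proj ` I" if "r \<in> Pos" "p \<in> proj ` I" for r p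
  proof -
    obtain x where x: "x \<in> I" "p = proj x" using \<open>p \<in> proj ` I\<close> by blast
    then have "x \<in> V" "r \<in> carrier R" using D(1) \<open>r \<in> Pos\<close> Pos_carrier by auto
    then show ?thesis using D(5)[OF _ x(1)] x by (simp add: proj_smult)
  qed
  fix p q assume p: "p \<in> carrier M'" and q: "q \<in> proj ` I" and le: "Q.modulus p \<sqsubseteq>\<^bsub>L'\<^esub> Q.modulus q"
  obtain x where x: "x \<in> V" "p = proj x" using p by (auto simp: carrier_M')
  obtain y where y: "y \<in> V" "y \<in> I" "q = proj y" using q D(1) by auto
  have "proj \<^bold>|x\<^bold>| \<sqsubseteq>\<^bsub>L'\<^esub> proj \<^bold>|y\<^bold>|" using le x y by (simp add: proj_modulus)
  then obtain i where i: "i \<in> J" "\<^bold>0 \<preceq> i" "\<^bold>|x\<^bold>| \<preceq> \<^bold>|y\<^bold>| \<^bold>+ i"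
    using proj_belowE[of "\<^bold>|x\<^bold>|" "\<^bold>|y\<^bold>|"] x y modulus_closed by blast
  have iV: "i \<in> V" using i J_carrier by simp
  have "x \<preceq> \<^bold>|y\<^bold>| \<^bold>+ i" "\<^bold>-x \<preceq> \<^bold>|y\<^bold>| \<^bold>+ i" using i(3) x y iV by (simp_all add: modulus_below_iff)
  moreover have "\<^bold>|y\<^bold>| \<^bold>+ i \<in> I" using D(4) lattice_ideal_modulus_iff[OF I(1) y(1)] y i I(2) by auto
  ultimately have "x \<in> I" using lattice_ideal_solid[OF I(1)] x by blast
  then show "p \<in> proj ` I" using x by blast
qed

end

section \<open>Positive scalars of an ordered field\<close>

locale ordered_field = field F + L: total_order L
  for F :: "('r, 'i) ring_scheme" (structure) and L :: "('r, 'j) gorder_scheme" (structure) +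
  assumes carrier_eq: "carrier L = carrier F"
    and add_right_mono:
      "\<lbrakk>x \<in> carrier F; y \<in> carrier F; z \<in> carrier F; x \<sqsubseteq>\<^bsub>L\<^esub> y\<rbrakk> \<Longrightarrow> x \<oplus>\<^bsub>F\<^esub> z \<sqsubseteq>\<^bsub>L\<^esub> y \<oplus>\<^bsub>F\<^esub> z"
    and mult_nonneg:
      "\<lbrakk>x \<in> carrier F; y \<in> carrier F; \<zero>\<^bsub>F\<^esub> \<sqsubseteq>\<^bsub>L\<^esub> x; \<zero>\<^bsub>F\<^esub> \<sqsubseteq>\<^bsub>L\<^esub> y\<rbrakk> \<Longrightarrow> \<zero>\<^bsub>F\<^esub> \<sqsubseteq>\<^bsub>L\<^esub> x \<otimes>\<^bsub>F\<^esub> y"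
begin

definition pos :: "'r set" where
  "pos = {r \<in> carrier F. \<zero>\<^bsub>F\<^esub> \<sqsubset>\<^bsub>L\<^esub> r}"

lemma pos_iff: "r \<in> pos \<longleftrightarrow> r \<in> carrier F \<and> \<zero>\<^bsub>F\<^esub> \<sqsubseteq>\<^bsub>L\<^esub> r \<and> r \<noteq> \<zero>\<^bsub>F\<^esub>"
  by (auto simp: pos_def lless_def L.eq_is_equal)

lemma le_antisym: "\<lbrakk>x \<sqsubseteq>\<^bsub>L\<^esub> y; y \<sqsubseteq>\<^bsub>L\<^esub> x; x \<in> carrier F; y \<in> carrier F\<rbrakk> \<Longrightarrow> x = y"
  by (rule L.le_antisym[unfolded carrier_eq])

lemma neg_nonneg:
  assumes "x \<in> carrier F" "x \<sqsubseteq>\<^bsub>L\<^esub> \<zero>\<^bsub>F\<^esub>"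
  shows "\<zero>\<^bsub>F\<^esub> \<sqsubseteq>\<^bsub>L\<^esub> \<ominus>\<^bsub>F\<^esub> x"
  using add_right_mono[of x "\<zero>\<^bsub>F\<^esub>" "\<ominus>\<^bsub>F\<^esub> x"] assms by (simp add: r_neg)

text \<open>
If 1 were negative, then -1 and hence \<open>(-1)(-1) = 1\<close> would be positive.
\<close>
lemma zero_le_one: "\<zero>\<^bsub>F\<^esub> \<sqsubseteq>\<^bsub>L\<^esub> \<one>\<^bsub>F\<^esub>"
proof (rule ccontr)
  assume contra: "\<not> ?thesis"
  then have "\<one>\<^bsub>F\<^esub> \<sqsubseteq>\<^bsub>L\<^esub> \<zero>\<^bsub>F\<^esub>" using L.total_order_total[unfolded carrier_eq, of "\<zero>\<^bsub>F\<^esub>" "\<one>\<^bsub>F\<^esub>"] by simp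
  then have "\<zero>\<^bsub>F\<^esub> \<sqsubseteq>\<^bsub>L\<^esub> \<ominus>\<^bsub>F\<^esub> \<one>\<^bsub>F\<^esub>" by (simp add: neg_nonneg)
  then have "\<zero>\<^bsub>F\<^esub> \<sqsubseteq>\<^bsub>L\<^esub> \<ominus>\<^bsub>F\<^esub> \<one>\<^bsub>F\<^esub> \<otimes>\<^bsub>F\<^esub> \<ominus>\<^bsub>F\<^esub> \<one>\<^bsub>F\<^esub>" by (simp add: mult_nonneg)
  then show False using contra by (simp add: l_minus r_minus)
qed

lemma pos_one: "\<one>\<^bsub>F\<^esub> \<in> pos"
  by (simp add: pos_iff zero_le_one)

lemma pos_add:
  assumes "r \<in> pos" "s \<in> pos"
  shows "r \<oplus>\<^bsub>F\<^esub> s \<in> pos"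
proof -
  have rs: "r \<in> carrier F" "s \<in> carrier F" "\<zero>\<^bsub>F\<^esub> \<sqsubseteq>\<^bsub>L\<^esub> r" "\<zero>\<^bsub>F\<^esub> \<sqsubseteq>\<^bsub>L\<^esub> s" "s \<noteq> \<zero>\<^bsub>F\<^esub>"
    using assms by (simp_all add: pos_iff)
  have s: "s \<sqsubseteq>\<^bsub>L\<^esub> r \<oplus>\<^bsub>F\<^esub> s" using add_right_mono[of "\<zero>\<^bsub>F\<^esub>" r s] rs by simp
  have "\<zero>\<^bsub>F\<^esub> \<sqsubseteq>\<^bsub>L\<^esub> r \<oplus>\<^bsub>F\<^esub> s"
    by (rule L.le_trans[unfolded carrier_eq, OF rs(4) s]) (use rs in simp_all)
  moreover have "r \<oplus>\<^bsub>F\<^esub> s \<noteq> \<zero>\<^bsub>F\<^esub>" using s rs le_antisym[of s "\<zero>\<^bsub>F\<^esub>"] by auto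
  ultimately show ?thesis using rs by (simp add: pos_iff)
qed

lemma pos_inverse:
  assumes "r \<in> pos"
  shows "\<exists>s\<in>pos. s \<otimes>\<^bsub>F\<^esub> r = \<one>\<^bsub>F\<^esub>"
proof -
  have r: "r \<in> carrier F" "\<zero>\<^bsub>F\<^esub> \<sqsubseteq>\<^bsub>L\<^esub> r" "r \<noteq> \<zero>\<^bsub>F\<^esub>" using assms by (simp_all add: pos_iff)
  then have "r \<in> Units F" by (simp add: field_Units)
  then obtain s where s: "s \<in> carrier F" "s \<otimes>\<^bsub>F\<^esub> r = \<one>\<^bsub>F\<^esub>" by (auto simp: Units_def)
  have "\<zero>\<^bsub>F\<^esub> \<sqsubseteq>\<^bsub>L\<^esub> s"
  proof (rule ccontr)
    assume "\<not> ?thesis"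
    then have "s \<sqsubseteq>\<^bsub>L\<^esub> \<zero>\<^bsub>F\<^esub>"
      using L.total_order_total[unfolded carrier_eq, of "\<zero>\<^bsub>F\<^esub>" s] s by simp
    then have "\<zero>\<^bsub>F\<^esub> \<sqsubseteq>\<^bsub>L\<^esub> \<ominus>\<^bsub>F\<^esub> s \<otimes>\<^bsub>F\<^esub> r" using s r by (simp add: mult_nonneg neg_nonneg)
    then have "\<zero>\<^bsub>F\<^esub> \<sqsubseteq>\<^bsub>L\<^esub> \<ominus>\<^bsub>F\<^esub> \<one>\<^bsub>F\<^esub>" using s r by (simp add: l_minus)
    then have "\<one>\<^bsub>F\<^esub> \<sqsubseteq>\<^bsub>L\<^esub> \<zero>\<^bsub>F\<^esub>"
      using add_right_mono[of "\<zero>\<^bsub>F\<^esub>" "\<ominus>\<^bsub>F\<^esub> \<one>\<^bsub>F\<^esub>" "\<one>\<^bsub>F\<^esub>"] by (simp add: l_neg)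
    then show False using le_antisym[OF _ zero_le_one] by simp
  qed
  moreover have "s \<noteq> \<zero>\<^bsub>F\<^esub>" using s r by auto
  ultimately show ?thesis using s by (auto simp: pos_iff)
qed

lemma pos_cases:
  assumes "r \<in> carrier F"
  shows "r \<in> pos \<or> r = \<zero>\<^bsub>F\<^esub> \<or> \<ominus>\<^bsub>F\<^esub> r \<in> pos"
proof -
  have "\<ominus>\<^bsub>F\<^esub> r \<noteq> \<zero>\<^bsub>F\<^esub>" if "r \<noteq> \<zero>\<^bsub>F\<^esub>" using that assms minus_minus[of r] by auto
  moreover have "\<zero>\<^bsub>F\<^esub> \<sqsubseteq>\<^bsub>L\<^esub> r \<or> r \<sqsubseteq>\<^bsub>L\<^esub> \<zero>\<^bsub>F\<^esub>"
    using L.total_order_total[unfolded carrier_eq, of "\<zero>\<^bsub>F\<^esub>" r] assms by simp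
  ultimately show ?thesis using assms neg_nonneg by (auto simp: pos_iff)
qed

end

section \<open>Definable sets in a model of ZF\<close>

text \<open>
Separation in a model is restricted to formulas, so every set needed below has to come with a formula.
The formulas are assembled from a few macros whose meaning under \<^const>\<open>sat\<close> is known to the simplifier.
\<close>
definition fm_Ex :: "nat \<Rightarrow> fm \<Rightarrow> fm" where "fm_Ex n p = Neg (All n (Neg p))"
definition fm_Or :: "fm \<Rightarrow> fm \<Rightarrow> fm" where "fm_Or p q = Neg (And (Neg p) (Neg q))"
definition fm_Imp :: "fm \<Rightarrow> fm \<Rightarrow> fm" where "fm_Imp p q = Neg (And p (Neg q))"
definition fm_Iff :: "fm \<Rightarrow> fm \<Rightarrow> fm" where "fm_Iff p q = And (fm_Imp p q) (fm_Imp q p)"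

lemma sat_connectives [simp]:
  "sat E s (fm_Ex n p) \<longleftrightarrow> (\<exists>a. sat E (s(n := a)) p)"
  "sat E s (fm_Or p q) \<longleftrightarrow> sat E s p \<or> sat E s q"
  "sat E s (fm_Imp p q) \<longleftrightarrow> (sat E s p \<longrightarrow> sat E s q)"
  "sat E s (fm_Iff p q) \<longleftrightarrow> (sat E s p \<longleftrightarrow> sat E s q)"
  by (auto simp: fm_Ex_def fm_Or_def fm_Imp_def fm_Iff_def)

text \<open>
Here and in the next macros the bound variables exceed all arguments, so they capture nothing.
\<close>
definition Is_upair :: "nat \<Rightarrow> nat \<Rightarrow> nat \<Rightarrow> fm" where
  "Is_upair k i j = (let m = Suc (i + j + k) in All m (fm_Iff (Mem m k) (fm_Or (Eq m i) (Eq m j))))"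

definition Is_opair :: "nat \<Rightarrow> nat \<Rightarrow> nat \<Rightarrow> fm" where
  "Is_opair k i j = (let m = Suc (i + j + k) in
     fm_Ex m (fm_Ex (Suc m) (And (Is_upair m i i) (And (Is_upair (Suc m) i j) (Is_upair k m (Suc m))))))"

definition Pair_mem :: "nat \<Rightarrow> nat \<Rightarrow> nat \<Rightarrow> fm" where
  "Pair_mem i j f = (let m = Suc (i + j + f) in fm_Ex m (And (Is_opair m i j) (Mem m f)))"

definition Triple_mem :: "nat \<Rightarrow> nat \<Rightarrow> nat \<Rightarrow> nat \<Rightarrow> fm" where
  "Triple_mem i j k f = (let m = Suc (i + j + k + f) in fm_Ex m (And (Is_opair m i j) (Pair_mem m k f)))"

context ZF_model
begin

lemma elts_iff [simp]: "x \<in> elts E a \<longleftrightarrow> x \<epsilon> a"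
  by (simp add: elts_def)

lemma eqI: "(\<And>x. x \<epsilon> a \<longleftrightarrow> x \<epsilon> b) \<Longrightarrow> a = b"
  using extensionality by blast

lemma elts_inject [simp]: "elts E a = elts E b \<longleftrightarrow> a = b"
  by (auto simp: set_eq_iff intro: eqI)

lemma mem_upair [simp]: "x \<epsilon> upair E a b \<longleftrightarrow> x = a \<or> x = b"
proof -
  obtain c where c: "\<forall>x. x \<epsilon> c \<longleftrightarrow> x = a \<or> x = b" using pairing by blast
  have "\<exists>!c. \<forall>x. x \<epsilon> c \<longleftrightarrow> x = a \<or> x = b"
    by (rule ex1I[of _ c]) (use c in \<open>auto intro!: eqI\<close>)
  from theI'[OF this] show ?thesis by (simp add: upair_def)
qed

lemma eq_upair_iff: "c = upair E a b \<longleftrightarrow> (\<forall>x. x \<epsilon> c \<longleftrightarrow> x = a \<or> x = b)"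
  by (auto intro: eqI)

lemma upair_eq_upair: "upair E a b = upair E c d \<longleftrightarrow> a = c \<and> b = d \<or> a = d \<and> b = c"
proof -
  have "upair E a b = upair E c d \<longleftrightarrow> {a, b} = {c, d}"
    unfolding eq_upair_iff mem_upair set_eq_iff by simp
  then show ?thesis by (simp add: doubleton_eq_iff)
qed

lemma opair_inject [simp]: "opair E a b = opair E c d \<longleftrightarrow> a = c \<and> b = d"
  unfolding opair_def upair_eq_upair by blast

lemma sat_Is_upair [simp]: "sat E s (Is_upair k i j) \<longleftrightarrow> s k = upair E (s i) (s j)"
  by (simp add: Is_upair_def Let_def eq_upair_iff)

lemma sat_Is_opair [simp]: "sat E s (Is_opair k i j) \<longleftrightarrow> s k = opair E (s i) (s j)"
  by (simp add: Is_opair_def Let_def opair_def)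

lemma sat_Pair_mem [simp]: "sat E s (Pair_mem i j f) \<longleftrightarrow> opair E (s i) (s j) \<epsilon> s f"
  by (simp add: Pair_mem_def Let_def)

lemma sat_Triple_mem [simp]:
  "sat E s (Triple_mem i j k f) \<longleftrightarrow> opair E (opair E (s i) (s j)) (s k) \<epsilon> s f"
  by (simp add: Triple_mem_def Let_def)

lemma mem_pairs [simp]: "opair E x y \<in> pairs E A B \<longleftrightarrow> x \<in> A \<and> y \<in> B"
  by (auto simp: pairs_def)

lemma ex_separation: "\<exists>b. \<forall>x. x \<epsilon> b \<longleftrightarrow> x \<epsilon> a \<and> sat E (s(0 := x)) p"
  using separation by blast

lemma ex_power: "\<exists>c. \<forall>x. x \<epsilon> c \<longleftrightarrow> elts E x \<subseteq> elts E a"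
  using power_set by (auto simp: subset_iff)

lemma ex_product: "\<exists>c. elts E c = pairs E (elts E a) (elts E b)"
proof -
  obtain d where d: "\<And>x. x \<epsilon> d \<longleftrightarrow> x = a \<or> x = b" using pairing by metis
  obtain u where u: "\<And>x. x \<epsilon> u \<longleftrightarrow> (\<exists>y. x \<epsilon> y \<and> y \<epsilon> d)" using union by metis
  obtain P where P: "\<And>x. x \<epsilon> P \<longleftrightarrow> elts E x \<subseteq> elts E u" using ex_power by metis
  obtain PP where PP: "\<And>x. x \<epsilon> PP \<longleftrightarrow> elts E x \<subseteq> elts E P" using ex_power by metis
  let ?s = "(\<lambda>_. a)(3 := a, 4 := b)"
  let ?p = "fm_Ex 1 (fm_Ex 2 (And (Mem 1 3) (And (Mem 2 4) (Is_opair 0 1 2))))"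
  obtain c where c: "\<And>x. x \<epsilon> c \<longleftrightarrow> x \<epsilon> PP \<and> sat E (?s(0 := x)) ?p" using ex_separation by metis
  \<comment> \<open>pairs of elements of \<open>a\<close> and \<open>b\<close> lie in the double power set of their union\<close>
  have "opair E x y \<epsilon> PP" if "x \<epsilon> a" "y \<epsilon> b" for x y
    using that by (auto simp: PP P u d subset_iff opair_def)
  then have "elts E c = pairs E (elts E a) (elts E b)" by (auto simp: c pairs_def)
  then show ?thesis by blast
qed

text \<open>
Variables 1 and 2 of the formula stand for the two components of a pair, and variable 0 for the pair itself.
\<close>
lemma ex_relation:
  "\<exists>r. \<forall>w. w \<epsilon> r \<longleftrightarrow> (\<exists>x y. x \<epsilon> a \<and> y \<epsilon> b \<and> w = opair E x y \<and> sat E (s(0 := w, 1 := x, 2 := y)) p)"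
proof -
  obtain c where c: "elts E c = pairs E (elts E a) (elts E b)" using ex_product by blast
  have "opair E x y \<epsilon> c \<longleftrightarrow> x \<epsilon> a \<and> y \<epsilon> b" for x y
    using mem_pairs[of x y "elts E a" "elts E b"] c[symmetric] by simp
  moreover obtain r where "\<And>w. w \<epsilon> r \<longleftrightarrow> w \<epsilon> c \<and> sat E (s(0 := w)) (fm_Ex 1 (fm_Ex 2 (And (Is_opair 0 1 2) p)))"
    using ex_separation by metis
  ultimately have "w \<epsilon> r \<longleftrightarrow> (\<exists>x y. x \<epsilon> a \<and> y \<epsilon> b \<and> w = opair E x y \<and> sat E (s(0 := w, 1 := x, 2 := y)) p)" for w
    by auto
  then show ?thesis by blast
qed

lemma is_fun_app:
  assumes "is_fun E f A B" "a \<in> A"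
  shows "app E f a \<in> B" "opair E a b \<epsilon> f \<longleftrightarrow> b = app E f a"
proof -
  have ex1: "\<exists>!b. opair E a b \<epsilon> f" and sub: "elts E f \<subseteq> pairs E A B"
    using assms by (auto simp: is_fun_def)
  have app: "opair E a (app E f a) \<epsilon> f" unfolding app_def by (rule theI'[OF ex1])
  then have "opair E a (app E f a) \<in> pairs E A B" using sub by auto
  then show "app E f a \<in> B" by simp
  show "opair E a b \<epsilon> f \<longleftrightarrow> b = app E f a" using app ex1 by blast
qed

lemma is_fun_graph:
  assumes graph: "\<And>w. w \<epsilon> f \<longleftrightarrow> (\<exists>a\<in>A. w = opair E a (F a))" and "\<And>a. a \<in> A \<Longrightarrow> F a \<in> B"
  shows "is_fun E f A B" "a \<in> A \<Longrightarrow> app E f a = F a"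
proof -
  show "is_fun E f A B" using assms by (auto simp: is_fun_def pairs_def)
  from is_fun_app(2)[OF this, of a "F a"] show "app E f a = F a" if "a \<in> A"
    using that by (auto simp: graph)
qed

end

section \<open>Vector lattices in a model\<close>

text \<open>
Through the extensions of its components, a vector lattice of the model becomes an instance of the
algebra of the preceding sections; the lemmas below translate between the two languages.
\<close>
locale vector_lattice_in_model = ZF_model E for E :: "'v \<Rightarrow> 'v \<Rightarrow> bool" (infix "\<epsilon>" 50) +
  fixes R :: "'v ordered_field_sys" and X :: "'v vector_lattice_sys"
  assumes reals: "is_reals E R" and vector_lattice: "vector_lattice E R X"
begin

lemma ordered_field_reals: "ordered_field (fring E R) (forder E R)"
proof -
  have "field (fring E R)" "total_order (forder E R)"
    using reals by (simp_all add: is_reals_def Let_def)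
  then show ?thesis
    using reals by (intro ordered_field.intro ordered_field_axioms.intro)
      (auto simp: is_reals_def Let_def fring_def forder_def)
qed

lemma pos_reals_eq: "pos_reals E R = ordered_field.pos (fring E R) (forder E R)"
  unfolding ordered_field.pos_def[OF ordered_field_reals] pos_reals_def by (simp add: fring_def)

lemma carrier_vmodule: "elts E (vcarrier X) = carrier (vmodule E X)"
  by (simp add: vmodule_def)

lemma vlattice: "vlattice (fring E R) (vmodule E X) (vorder E X) (pos_reals E R)"
proof -
  interpret F: ordered_field "fring E R" "forder E R" by (rule ordered_field_reals)
  have "module (fring E R) (vmodule E X)" "lattice (vorder E X)"
    using vector_lattice by (simp_all add: vector_lattice_def Let_def)
  then show ?thesis
  proof (intro vlattice.intro vlattice_axioms.intro)
    show "carrier (vorder E X) = carrier (vmodule E X)" by (simp add: vorder_def vmodule_def)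
    show "pos_reals E R \<subseteq> carrier (fring E R)" by (auto simp: pos_reals_def fring_def)
  qed (use vector_lattice in \<open>auto simp: vector_lattice_def Let_def carrier_vmodule pos_reals_eq
      F.pos_one F.pos_add F.pos_inverse F.pos_cases\<close>)
qed

sublocale vlattice "fring E R" "vmodule E X" "vorder E X" "pos_reals E R"
  by (rule vlattice)

notation plus (infixl "\<^bold>+" 65)
notation neg ("\<^bold>-_" [81] 80)
notation nought ("\<^bold>0")
notation scale (infixr "\<^bold>*" 70)
notation below (infix "\<preceq>" 50)
notation modulus ("\<^bold>|_\<^bold>|")

lemma mem_vcarrier [simp]: "x \<epsilon> vcarrier X \<longleftrightarrow> x \<in> V"
  by (simp add: carrier_vmodule[symmetric])

lemma mem_fcarrier [simp]: "r \<epsilon> fcarrier R \<longleftrightarrow> r \<in> carrier (fring E R)"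
  by (simp add: fring_def)

lemma vzero_eq: "vzero X = \<^bold>0"
  by (simp add: vmodule_def)

lemma vle_iff: "opair E x y \<epsilon> vle X \<longleftrightarrow> x \<preceq> y"
  by (simp add: vorder_def)

lemma below_carrier: "x \<preceq> y \<Longrightarrow> x \<in> V \<and> y \<in> V"
proof -
  assume "x \<preceq> y"
  then have "opair E x y \<in> pairs E V V"
    using vector_lattice by (auto simp: vector_lattice_def Let_def vle_iff[symmetric] carrier_vmodule)
  then show ?thesis by simp
qed

lemma vadd_iff:
  assumes "x \<in> V" "y \<in> V"
  shows "opair E (opair E x y) z \<epsilon> vadd X \<longleftrightarrow> z = x \<^bold>+ y"
proof -
  have "is_fun E (vadd X) (pairs E V V) V"
    using vector_lattice unfolding vector_lattice_def Let_def carrier_vmodule by (elim conjE)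
  moreover have "x \<^bold>+ y = app E (vadd X) (opair E x y)" by (simp add: vmodule_def)
  ultimately show ?thesis using is_fun_app(2)[of "vadd X" _ V "opair E x y" z] assms by simp
qed

lemma vsmult_iff:
  assumes "r \<in> carrier (fring E R)" "x \<in> V"
  shows "opair E (opair E r x) z \<epsilon> vsmult X \<longleftrightarrow> z = r \<^bold>* x"
proof -
  have "is_fun E (vsmult X) (pairs E (elts E (fcarrier R)) V) V"
    using vector_lattice unfolding vector_lattice_def Let_def carrier_vmodule by (elim conjE)
  moreover have "r \<^bold>* x = app E (vsmult X) (opair E r x)" by (simp add: vmodule_def)
  ultimately show ?thesis using is_fun_app(2)[of "vsmult X" _ V "opair E r x" z] assms by simp
qed

lemma vl_ideal_iff: "vl_ideal E R X J \<longleftrightarrow> lattice_ideal (elts E J)"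
  by (simp add: vl_ideal_def lattice_ideal_def vabs_def carrier_vmodule)

lemma pos_cone_iff [simp]: "x \<in> pos_cone E X \<longleftrightarrow> x \<in> V \<and> \<^bold>0 \<preceq> x"
  by (simp add: pos_cone_def vzero_eq)

lemma strong_unit_iff:
  "strong_unit E R X u \<longleftrightarrow>
     u \<in> V \<and> \<^bold>0 \<preceq> u \<and> (\<forall>x\<in>V. \<exists>r\<in>pos_reals E R. \<^bold>|x\<^bold>| \<preceq> r \<^bold>* u)"
  by (auto simp: strong_unit_def principal_ideal_def carrier_vmodule vabs_def)

lemma vl_maximal_ideal_iff:
  "vl_maximal_ideal E R X J \<longleftrightarrow> lattice_ideal (elts E J) \<and> elts E J \<noteq> V \<and>
     (\<forall>I. lattice_ideal (elts E I) \<and> elts E J \<subset> elts E I \<longrightarrow> elts E I = V)"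
  unfolding vl_maximal_ideal_def vl_ideal_iff carrier_vmodule[symmetric] elts_inject by blast

text \<open>
The polar of an element of the model is definable from the addition and the order, so it exists in the model.
\<close>
lemma ex_polar: "\<exists>J. elts E J = polar e"
proof -
  \<comment> \<open>variable 8 is left at its default, the parameter \<open>e\<close>; variable 1 is the bound \<open>m\<close>, and variable 2 is the negative of variable 0\<close>
  let ?s = "(\<lambda>_. e)(3 := vcarrier X, 4 := vadd X, 5 := vle X, 6 := \<^bold>0)"
  let ?p = "fm_Ex 1 (fm_Ex 2 (And (And (Mem 1 3) (Pair_mem 6 1 5)) (And (And (Pair_mem 0 1 5) (Pair_mem 2 1 5))
      (And (And (Mem 2 3) (Triple_mem 0 2 6 4)) (All 7 (fm_Imp (And (Mem 7 3) (And (Pair_mem 7 1 5) (Pair_mem 7 8 5)))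
        (Pair_mem 7 6 5)))))))"
  obtain J where J: "\<And>x. x \<epsilon> J \<longleftrightarrow> x \<epsilon> vcarrier X \<and> sat E (?s(0 := x)) ?p"
    using ex_separation by metis
  have neg: "opair E (opair E x y) \<^bold>0 \<epsilon> vadd X \<longleftrightarrow> y = \<^bold>-x" if "x \<in> V" "y \<in> V" for x y
  proof -
    have "\<^bold>0 = x \<^bold>+ y \<longleftrightarrow> y = \<^bold>-x"
    proof
      assume "\<^bold>0 = x \<^bold>+ y"
      then have "y \<^bold>+ x = \<^bold>0" using that M.a_comm[of x y] by simp
      then show "y = \<^bold>-x" using that M.minus_equality by simp
    qed (use that in \<open>simp add: M.r_neg\<close>)
    then show ?thesis using that by (simp add: vadd_iff)
  qed
  have sat: "sat E (?s(0 := x)) ?p \<longleftrightarrow> (\<exists>m y. (m \<in> V \<and> \<^bold>0 \<preceq> m) \<and> (x \<preceq> m \<and> y \<preceq> m) \<and>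
      (y \<in> V \<and> opair E (opair E x y) \<^bold>0 \<epsilon> vadd X) \<and> (\<forall>c. c \<in> V \<and> c \<preceq> m \<and> c \<preceq> e \<longrightarrow> c \<preceq> \<^bold>0))" for x
    by (simp add: vle_iff)
  have "x \<epsilon> J \<longleftrightarrow> x \<in> polar e" for x
  proof
    assume "x \<epsilon> J"
    then have "x \<in> V \<and> sat E (?s(0 := x)) ?p" unfolding J mem_vcarrier .
    then obtain x: "x \<in> V" and sat_x: "sat E (?s(0 := x)) ?p" by (rule conjE)
    from sat_x[unfolded sat] obtain m y where m: "m \<in> V" "\<^bold>0 \<preceq> m" "x \<preceq> m" "y \<preceq> m"
        and y: "y \<in> V" "opair E (opair E x y) \<^bold>0 \<epsilon> vadd X"
        and disj: "\<forall>c. c \<in> V \<and> c \<preceq> m \<and> c \<preceq> e \<longrightarrow> c \<preceq> \<^bold>0"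
      by (elim exE conjE)
    have "\<^bold>-x \<preceq> m" using neg[OF x y(1)] y(2) m(4) by simp
    then show "x \<in> polar e" by (rule polarI[OF x m(1-3)]) (simp add: disj)
  next
    assume "x \<in> polar e"
    then obtain m where x: "x \<in> V" and m: "m \<in> V" "\<^bold>0 \<preceq> m" "x \<preceq> m" "\<^bold>-x \<preceq> m"
        and disj: "\<And>c. \<lbrakk>c \<in> V; c \<preceq> m; c \<preceq> e\<rbrakk> \<Longrightarrow> c \<preceq> \<^bold>0"
      by (elim polarE) blast
    have "\<^bold>-x \<in> V" using x by simp
    moreover have "opair E (opair E x (\<^bold>-x)) \<^bold>0 \<epsilon> vadd X" using neg[of x "\<^bold>-x"] x by simp
    ultimately have "sat E (?s(0 := x)) ?p"
      unfolding sat by (rule_tac exI[of _ m], rule_tac exI[of _ "\<^bold>-x"]) (use m disj in simp)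
    with x show "x \<epsilon> J" unfolding J mem_vcarrier by (rule conjI)
  qed
  then have "elts E J = polar e" by (simp add: set_eq_iff)
  then show ?thesis by (rule exI)
qed

end

section \<open>Quotients in a model\<close>

locale quotient_in_model = vector_lattice_in_model E R X
  for E :: "'v \<Rightarrow> 'v \<Rightarrow> bool" (infix "\<epsilon>" 50) and R X +
  fixes J :: 'v
  assumes lattice_ideal_J: "lattice_ideal (elts E J)"
begin

lemma mem_J_carrier: "i \<epsilon> J \<Longrightarrow> i \<in> V"
  using lattice_idealD(1)[OF lattice_ideal_J] by auto

text \<open>
The elements of the quotient are the cosets themselves, as elements of the model; no representatives
have to be chosen inside the model.
\<close>
definition coset :: "'v \<Rightarrow> 'v" where
  "coset x = (THE c. \<forall>y. y \<epsilon> c \<longleftrightarrow> (\<exists>i. i \<epsilon> J \<and> y = x \<^bold>+ i))"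

lemma mem_coset:
  assumes x: "x \<in> V"
  shows "y \<epsilon> coset x \<longleftrightarrow> (\<exists>i. i \<epsilon> J \<and> y = x \<^bold>+ i)"
proof -
  \<comment> \<open>variable 2 is left at its default \<open>x\<close>\<close>
  let ?s = "(\<lambda>_. x)(3 := J, 4 := vadd X)"
  obtain c where c: "\<And>y. y \<epsilon> c \<longleftrightarrow> y \<epsilon> vcarrier X \<and> sat E (?s(0 := y)) (fm_Ex 1 (And (Mem 1 3) (Triple_mem 2 1 0 4)))"
    using ex_separation by metis
  have "y \<epsilon> c \<longleftrightarrow> (\<exists>i. i \<epsilon> J \<and> y = x \<^bold>+ i)" for y
    using x mem_J_carrier by (auto simp: c vadd_iff)
  then have "\<exists>!c. \<forall>y. y \<epsilon> c \<longleftrightarrow> (\<exists>i. i \<epsilon> J \<and> y = x \<^bold>+ i)"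
    by (intro ex1I[of _ c]) (auto intro!: eqI)
  from theI'[OF this] show ?thesis by (simp add: coset_def)
qed

lemma mem_coset_iff:
  assumes "x \<in> V"
  shows "y \<epsilon> coset x \<longleftrightarrow> y \<in> V \<and> y \<^bold>+ \<^bold>-x \<epsilon> J"
proof
  assume "y \<epsilon> coset x"
  then obtain i where i: "i \<epsilon> J" "y = x \<^bold>+ i" using assms by (auto simp: mem_coset)
  then have "y \<^bold>+ \<^bold>-x = i" using assms mem_J_carrier[OF i(1)] by (simp add: M.a_assoc M.a_comm M.a_lcomm M.r_neg)
  then show "y \<in> V \<and> y \<^bold>+ \<^bold>-x \<epsilon> J" using i assms mem_J_carrier by simp
next
  assume y: "y \<in> V \<and> y \<^bold>+ \<^bold>-x \<epsilon> J"
  have "x \<^bold>+ (y \<^bold>+ \<^bold>-x) = y \<^bold>+ (x \<^bold>+ \<^bold>-x)" using assms y by (intro M.a_lcomm) simp_all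
  then have "y = x \<^bold>+ (y \<^bold>+ \<^bold>-x)" using assms y by (simp add: M.r_neg)
  then show "y \<epsilon> coset x" using assms y by (auto simp: mem_coset)
qed

lemma self_mem_coset: "x \<in> V \<Longrightarrow> x \<epsilon> coset x"
  using lattice_idealD(2)[OF lattice_ideal_J] by (simp add: mem_coset_iff M.r_neg)

lemma coset_eq_iff:
  assumes "x \<in> V" "y \<in> V"
  shows "coset x = coset y \<longleftrightarrow> x \<^bold>+ \<^bold>-y \<epsilon> J"
proof
  assume "coset x = coset y"
  then show "x \<^bold>+ \<^bold>-y \<epsilon> J" using self_mem_coset[of x] assms by (simp add: mem_coset_iff)
next
  note D = lattice_idealD[OF lattice_ideal_J, simplified]
  assume xy: "x \<^bold>+ \<^bold>-y \<epsilon> J"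
  show "coset x = coset y"
  proof (rule eqI)
    fix z
    have "z \<^bold>+ \<^bold>-x \<epsilon> J \<longleftrightarrow> z \<^bold>+ \<^bold>-y \<epsilon> J" if z: "z \<in> V"
    proof
      assume "z \<^bold>+ \<^bold>-x \<epsilon> J"
      then have "(z \<^bold>+ \<^bold>-x) \<^bold>+ (x \<^bold>+ \<^bold>-y) \<epsilon> J" using xy by (rule D(4))
      moreover have "(z \<^bold>+ \<^bold>-x) \<^bold>+ (x \<^bold>+ \<^bold>-y) = z \<^bold>+ ((x \<^bold>+ \<^bold>-x) \<^bold>+ \<^bold>-y)"
        using assms z by (simp add: M.a_ac)
      ultimately show "z \<^bold>+ \<^bold>-y \<epsilon> J" using assms z by (simp add: M.r_neg)
    next
      assume "z \<^bold>+ \<^bold>-y \<epsilon> J"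
      then have "(z \<^bold>+ \<^bold>-y) \<^bold>+ \<^bold>-(x \<^bold>+ \<^bold>-y) \<epsilon> J" using D(3)[OF xy] by (rule D(4))
      moreover have "(z \<^bold>+ \<^bold>-y) \<^bold>+ \<^bold>-(x \<^bold>+ \<^bold>-y) = z \<^bold>+ ((y \<^bold>+ \<^bold>-y) \<^bold>+ \<^bold>-x)"
        using assms z by (simp add: M.minus_add M.a_ac)
      ultimately show "z \<^bold>+ \<^bold>-x \<epsilon> J" using assms z by (simp add: M.r_neg)
    qed
    then show "z \<epsilon> coset x \<longleftrightarrow> z \<epsilon> coset y" using assms by (auto simp: mem_coset_iff)
  qed
qed

lemma mem_coset_iff_eq: "x \<in> V \<Longrightarrow> y \<epsilon> coset x \<longleftrightarrow> y \<in> V \<and> coset y = coset x"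
  by (auto simp: mem_coset_iff coset_eq_iff)

text \<open>
The quotient is cut out of the power set of the carrier by the formula that says that a set is a coset.
\<close>
lemma ex_quotient: "\<exists>Q. elts E Q = coset ` V"
proof -
  obtain P where P: "\<And>x. x \<epsilon> P \<longleftrightarrow> elts E x \<subseteq> elts E (vcarrier X)" using ex_power by metis
  \<comment> \<open>variable 6 is left at its default \<open>J\<close>\<close>
  let ?s = "(\<lambda>_. J)(3 := vcarrier X, 4 := vadd X)"
  let ?p = "fm_Ex 1 (And (Mem 1 3) (All 2 (fm_Iff (Mem 2 0) (fm_Ex 5 (And (Mem 5 6) (Triple_mem 1 5 2 4))))))"
  obtain Q where Q: "\<And>c. c \<epsilon> Q \<longleftrightarrow> c \<epsilon> P \<and> sat E (?s(0 := c)) ?p" using ex_separation by metis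
  have sat: "sat E (?s(0 := c)) ?p \<longleftrightarrow> (\<exists>x\<in>V. \<forall>y. y \<epsilon> c \<longleftrightarrow> y \<epsilon> coset x)" for c
    using mem_J_carrier by (auto simp: mem_coset vadd_iff cong: conj_cong)
  have "c \<epsilon> Q \<longleftrightarrow> c \<in> coset ` V" for c
  proof
    assume "c \<epsilon> Q"
    then obtain x where "x \<in> V" "\<forall>y. y \<epsilon> c \<longleftrightarrow> y \<epsilon> coset x" unfolding Q sat by blast
    then show "c \<in> coset ` V" using eqI[of c "coset x"] by blast
  next
    assume "c \<in> coset ` V"
    then obtain x where "x \<in> V" "c = coset x" by blast
    then show "c \<epsilon> Q" unfolding Q sat P by (auto simp: mem_coset_iff)
  qed
  then have "elts E Q = coset ` V" by (simp add: set_eq_iff)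
  then show ?thesis by (rule exI)
qed

definition quot_carrier :: 'v where "quot_carrier = (SOME Q. elts E Q = coset ` V)"

lemma quot_carrier: "elts E quot_carrier = coset ` V"
  unfolding quot_carrier_def using ex_quotient by (rule someI_ex)

lemma mem_quot_carrier [simp]: "c \<epsilon> quot_carrier \<longleftrightarrow> c \<in> coset ` V"
  using quot_carrier by (simp add: set_eq_iff)

lemma mem_quot_carrierD: "c \<in> coset ` V \<Longrightarrow> x \<epsilon> c \<Longrightarrow> x \<in> V \<and> c = coset x"
  by (auto simp: mem_coset_iff_eq)

lemma coset_mem_quot_carrier: "x \<in> V \<Longrightarrow> coset x \<epsilon> quot_carrier"
  by simp

text \<open>
The operations and the order of the quotient are the images of those of \<open>X\<close>: they relate cosets that
contain related elements.
\<close>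
lemma ex_quot_add:
  "\<exists>f. \<forall>w. w \<epsilon> f \<longleftrightarrow> (\<exists>x\<in>V. \<exists>y\<in>V. w = opair E (opair E (coset x) (coset y)) (coset (x \<^bold>+ y)))"
proof -
  obtain D where "elts E D = pairs E (elts E quot_carrier) (elts E quot_carrier)" using ex_product by blast
  then have D: "p \<epsilon> D \<longleftrightarrow> p \<in> pairs E (coset ` V) (coset ` V)" for p
    by (simp add: set_eq_iff quot_carrier)
  \<comment> \<open>variable 8 is left at its default, the addition\<close>
  let ?s = "(\<lambda>_. vadd X)"
  let ?p = "fm_Ex 3 (fm_Ex 4 (And (Is_opair 1 3 4) (fm_Ex 5 (fm_Ex 6 (fm_Ex 7 (And (And (Mem 5 3) (Mem 6 4))
     (And (Mem 7 2) (Triple_mem 5 6 7 8))))))))"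
  obtain f where f: "\<forall>w. w \<epsilon> f \<longleftrightarrow> (\<exists>p q. p \<epsilon> D \<and> q \<epsilon> quot_carrier \<and> w = opair E p q \<and>
      sat E (?s(0 := w, 1 := p, 2 := q)) ?p)"
    using ex_relation[of D quot_carrier ?s ?p] by (rule exE)
  have "w \<epsilon> f \<longleftrightarrow> (\<exists>x\<in>V. \<exists>y\<in>V. w = opair E (opair E (coset x) (coset y)) (coset (x \<^bold>+ y)))" for w
  proof
    assume "w \<epsilon> f"
    then obtain a b c x y z where "a \<in> V" "b \<in> V" "c \<in> V"
        and w: "w = opair E (opair E (coset a) (coset b)) (coset c)"
        and "x \<epsilon> coset a" "y \<epsilon> coset b" "z \<epsilon> coset c"
        and xyz: "opair E (opair E x y) z \<epsilon> vadd X"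
      by (auto simp: f D)
    then have x: "x \<in> V" "coset x = coset a" and y: "y \<in> V" "coset y = coset b"
        and z: "z \<in> V" "coset z = coset c"
      by (simp_all add: mem_coset_iff_eq)
    then have "z = x \<^bold>+ y" using xyz by (simp add: vadd_iff)
    then show "\<exists>x\<in>V. \<exists>y\<in>V. w = opair E (opair E (coset x) (coset y)) (coset (x \<^bold>+ y))"
      using w x y z by metis
  next
    assume "\<exists>x\<in>V. \<exists>y\<in>V. w = opair E (opair E (coset x) (coset y)) (coset (x \<^bold>+ y))"
    then obtain x y where x: "x \<in> V" and y: "y \<in> V"
      and w: "w = opair E (opair E (coset x) (coset y)) (coset (x \<^bold>+ y))" by blast
    have "\<exists>a b c. a \<epsilon> coset x \<and> b \<epsilon> coset y \<and> c \<epsilon> coset (x \<^bold>+ y) \<and> opair E (opair E a b) c \<epsilon> vadd X"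
      using x y by (intro exI[of _ x] exI[of _ y] exI[of _ "x \<^bold>+ y"]) (simp add: self_mem_coset vadd_iff)
    then show "w \<epsilon> f" using x y by (simp add: f D w coset_mem_quot_carrier del: mem_quot_carrier)
  qed
  then show ?thesis by blast
qed

lemma ex_quot_smult:
  "\<exists>f. \<forall>w. w \<epsilon> f \<longleftrightarrow>
     (\<exists>r\<in>carrier (fring E R). \<exists>x\<in>V. w = opair E (opair E r (coset x)) (coset (r \<^bold>* x)))"
proof -
  obtain D where "elts E D = pairs E (elts E (fcarrier R)) (elts E quot_carrier)" using ex_product by blast
  then have D: "p \<epsilon> D \<longleftrightarrow> p \<in> pairs E (elts E (fcarrier R)) (coset ` V)" for p
    by (simp add: set_eq_iff quot_carrier)
  \<comment> \<open>variable 8 is left at its default, the scalar multiplication\<close>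
  let ?s = "(\<lambda>_. vsmult X)"
  let ?p = "fm_Ex 3 (fm_Ex 4 (And (Is_opair 1 3 4) (fm_Ex 5 (fm_Ex 6 (And (Mem 5 4)
     (And (Mem 6 2) (Triple_mem 3 5 6 8)))))))"
  obtain f where f: "\<forall>w. w \<epsilon> f \<longleftrightarrow> (\<exists>p q. p \<epsilon> D \<and> q \<epsilon> quot_carrier \<and> w = opair E p q \<and>
      sat E (?s(0 := w, 1 := p, 2 := q)) ?p)"
    using ex_relation[of D quot_carrier ?s ?p] by (rule exE)
  have "w \<epsilon> f \<longleftrightarrow>
     (\<exists>r\<in>carrier (fring E R). \<exists>x\<in>V. w = opair E (opair E r (coset x)) (coset (r \<^bold>* x)))" for w
  proof
    assume "w \<epsilon> f"
    then obtain r a c x z where r: "r \<in> carrier (fring E R)" and "a \<in> V" "c \<in> V"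
        and w: "w = opair E (opair E r (coset a)) (coset c)"
        and "x \<epsilon> coset a" "z \<epsilon> coset c" and xz: "opair E (opair E r x) z \<epsilon> vsmult X"
      by (auto simp: f D)
    then have x: "x \<in> V" "coset x = coset a" and z: "z \<in> V" "coset z = coset c"
      by (simp_all add: mem_coset_iff_eq)
    then have "z = r \<^bold>* x" using xz r by (simp add: vsmult_iff)
    then show "\<exists>r\<in>carrier (fring E R). \<exists>x\<in>V. w = opair E (opair E r (coset x)) (coset (r \<^bold>* x))"
      using w x z r by metis
  next
    assume "\<exists>r\<in>carrier (fring E R). \<exists>x\<in>V. w = opair E (opair E r (coset x)) (coset (r \<^bold>* x))"
    then obtain r x where r: "r \<in> carrier (fring E R)" and x: "x \<in> V"
      and w: "w = opair E (opair E r (coset x)) (coset (r \<^bold>* x))" by blast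
    have "\<exists>a c. a \<epsilon> coset x \<and> c \<epsilon> coset (r \<^bold>* x) \<and> opair E (opair E r a) c \<epsilon> vsmult X"
      using r x by (intro exI[of _ x] exI[of _ "r \<^bold>* x"]) (simp add: self_mem_coset vsmult_iff)
    then show "w \<epsilon> f" using r x by (simp add: f D w coset_mem_quot_carrier del: mem_quot_carrier)
  qed
  then show ?thesis by blast
qed

lemma ex_quot_le:
  "\<exists>f. \<forall>w. w \<epsilon> f \<longleftrightarrow> (\<exists>x y. x \<preceq> y \<and> w = opair E (coset x) (coset y))"
proof -
  \<comment> \<open>variable 5 is left at its default, the order\<close>
  let ?s = "(\<lambda>_. vle X)"
  let ?p = "fm_Ex 3 (fm_Ex 4 (And (And (Mem 3 1) (Mem 4 2)) (Pair_mem 3 4 5)))"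
  obtain f where f: "\<forall>w. w \<epsilon> f \<longleftrightarrow> (\<exists>p q. p \<epsilon> quot_carrier \<and> q \<epsilon> quot_carrier \<and> w = opair E p q \<and>
      sat E (?s(0 := w, 1 := p, 2 := q)) ?p)"
    using ex_relation[of quot_carrier quot_carrier ?s ?p] by (rule exE)
  have "w \<epsilon> f \<longleftrightarrow> (\<exists>x y. x \<preceq> y \<and> w = opair E (coset x) (coset y))" for w
  proof
    assume "w \<epsilon> f"
    then obtain a b x y where "a \<in> V" "b \<in> V" and w: "w = opair E (coset a) (coset b)"
        and "x \<epsilon> coset a" "y \<epsilon> coset b" and xy: "x \<preceq> y"
      by (auto simp: f vle_iff)
    then have "coset x = coset a" "coset y = coset b" by (simp_all add: mem_coset_iff_eq)
    then show "\<exists>x y. x \<preceq> y \<and> w = opair E (coset x) (coset y)" using w xy by metis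
  next
    assume "\<exists>x y. x \<preceq> y \<and> w = opair E (coset x) (coset y)"
    then obtain x y where xy: "x \<preceq> y" and w: "w = opair E (coset x) (coset y)" by blast
    have V: "x \<in> V" "y \<in> V" using below_carrier[OF xy] by simp_all
    have "\<exists>a b. a \<epsilon> coset x \<and> b \<epsilon> coset y \<and> opair E a b \<epsilon> vle X"
      using V xy by (intro exI[of _ x] exI[of _ y]) (simp add: self_mem_coset vle_iff)
    then show "w \<epsilon> f" using V by (simp add: f w coset_mem_quot_carrier del: mem_quot_carrier)
  qed
  then show ?thesis by blast
qed

text \<open>
The operator \<open>SOME\<close> only names sets that are unique by extensionality.
\<close>
definition quot :: "'v vector_lattice_sys" where
  "quot = \<lparr>vcarrier = quot_carrier,
     vadd = (SOME f. \<forall>w. w \<epsilon> f \<longleftrightarrow>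
       (\<exists>x\<in>V. \<exists>y\<in>V. w = opair E (opair E (coset x) (coset y)) (coset (x \<^bold>+ y)))),
     vzero = coset \<^bold>0,
     vsmult = (SOME f. \<forall>w. w \<epsilon> f \<longleftrightarrow>
       (\<exists>r\<in>carrier (fring E R). \<exists>x\<in>V. w = opair E (opair E r (coset x)) (coset (r \<^bold>* x)))),
     vle = (SOME f. \<forall>w. w \<epsilon> f \<longleftrightarrow> (\<exists>x y. x \<preceq> y \<and> w = opair E (coset x) (coset y)))\<rparr>"

lemma quot_simps [simp]: "vcarrier quot = quot_carrier" "vzero quot = coset \<^bold>0"
  by (simp_all add: quot_def)

lemma mem_vadd_quot:
  "w \<epsilon> vadd quot \<longleftrightarrow> (\<exists>x\<in>V. \<exists>y\<in>V. w = opair E (opair E (coset x) (coset y)) (coset (x \<^bold>+ y)))"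
  using someI_ex[OF ex_quot_add] by (simp add: quot_def)

lemma mem_vsmult_quot:
  "w \<epsilon> vsmult quot \<longleftrightarrow>
     (\<exists>r\<in>carrier (fring E R). \<exists>x\<in>V. w = opair E (opair E r (coset x)) (coset (r \<^bold>* x)))"
  using someI_ex[OF ex_quot_smult] by (simp add: quot_def)

lemma mem_vle_quot: "w \<epsilon> vle quot \<longleftrightarrow> (\<exists>x y. x \<preceq> y \<and> w = opair E (coset x) (coset y))"
  using someI_ex[OF ex_quot_le] by (simp add: quot_def)

lemma coset_add_cong:
  assumes "x \<in> V" "y \<in> V" "x' \<in> V" "y' \<in> V" "coset x = coset x'" "coset y = coset y'"
  shows "coset (x \<^bold>+ y) = coset (x' \<^bold>+ y')"
proof -
  have "x \<^bold>+ \<^bold>-x' \<epsilon> J" "y \<^bold>+ \<^bold>-y' \<epsilon> J" using assms by (simp_all add: coset_eq_iff)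
  then have "(x \<^bold>+ \<^bold>-x') \<^bold>+ (y \<^bold>+ \<^bold>-y') \<epsilon> J" by (rule lattice_idealD(4)[OF lattice_ideal_J, simplified])
  moreover have "(x \<^bold>+ \<^bold>-x') \<^bold>+ (y \<^bold>+ \<^bold>-y') = (x \<^bold>+ y) \<^bold>+ \<^bold>-(x' \<^bold>+ y')"
    using assms by (simp add: M.minus_add M.a_ac)
  ultimately show ?thesis using assms by (simp add: coset_eq_iff)
qed

lemma coset_smult_cong:
  assumes "r \<in> carrier (fring E R)" "x \<in> V" "x' \<in> V" "coset x = coset x'"
  shows "coset (r \<^bold>* x) = coset (r \<^bold>* x')"
proof -
  have "x \<^bold>+ \<^bold>-x' \<epsilon> J" using assms by (simp add: coset_eq_iff)
  then have "r \<^bold>* (x \<^bold>+ \<^bold>-x') \<epsilon> J" using lattice_idealD(5)[OF lattice_ideal_J assms(1)] by simp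
  then show ?thesis using assms by (simp add: coset_eq_iff smult_r_distr smult_r_minus)
qed

lemma vadd_quot_iff:
  assumes "x \<in> V" "y \<in> V"
  shows "opair E (opair E (coset x) (coset y)) c \<epsilon> vadd quot \<longleftrightarrow> c = coset (x \<^bold>+ y)"
  using assms coset_add_cong[OF _ _ assms] unfolding mem_vadd_quot opair_inject by metis

lemma vsmult_quot_iff:
  assumes "r \<in> carrier (fring E R)" "x \<in> V"
  shows "opair E (opair E r (coset x)) c \<epsilon> vsmult quot \<longleftrightarrow> c = coset (r \<^bold>* x)"
  using assms coset_smult_cong[OF assms(1) _ assms(2)] unfolding mem_vsmult_quot opair_inject by metis

lemma is_fun_vadd_quot: "is_fun E (vadd quot) (pairs E (coset ` V) (coset ` V)) (coset ` V)"
proof -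
  have "elts E (vadd quot) \<subseteq> pairs E (pairs E (coset ` V) (coset ` V)) (coset ` V)"
    by (auto simp: mem_vadd_quot)
  moreover have "\<exists>!b. opair E a b \<epsilon> vadd quot" if "a \<in> pairs E (coset ` V) (coset ` V)" for a
    using that by (auto simp: pairs_def vadd_quot_iff)
  ultimately show ?thesis by (simp add: is_fun_def)
qed

lemma is_fun_vsmult_quot:
  "is_fun E (vsmult quot) (pairs E (carrier (fring E R)) (coset ` V)) (coset ` V)"
proof -
  have "elts E (vsmult quot) \<subseteq> pairs E (pairs E (carrier (fring E R)) (coset ` V)) (coset ` V)"
    by (auto simp: mem_vsmult_quot)
  moreover have "\<exists>!b. opair E a b \<epsilon> vsmult quot" if "a \<in> pairs E (carrier (fring E R)) (coset ` V)" for a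
    using that by (auto simp: pairs_def vsmult_quot_iff)
  ultimately show ?thesis by (simp add: is_fun_def)
qed

text \<open>
If \<open>x' \<le> y'\<close> for elements of the two cosets, the differences \<open>x - x'\<close> and \<open>y' - y\<close> add up to an error in \<open>J\<close>
with \<open>x \<le> y + error\<close>.
\<close>
lemma vle_quot_iff:
  assumes "x \<in> V" "y \<in> V"
  shows "opair E (coset x) (coset y) \<epsilon> vle quot \<longleftrightarrow> (\<exists>i. i \<epsilon> J \<and> x \<preceq> y \<^bold>+ i)"
proof
  assume "opair E (coset x) (coset y) \<epsilon> vle quot"
  then obtain x' y' where le: "x' \<preceq> y'" and eq: "coset x = coset x'" "coset y = coset y'"
    by (auto simp: mem_vle_quot)
  have V: "x' \<in> V" "y' \<in> V" using below_carrier[OF le] by simp_all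
  then have J: "x \<^bold>+ \<^bold>-x' \<epsilon> J" "y' \<^bold>+ \<^bold>-y \<epsilon> J" using eq assms coset_eq_iff[of x x'] coset_eq_iff[of y' y] by simp_all
  then have mem: "(y' \<^bold>+ \<^bold>-y) \<^bold>+ (x \<^bold>+ \<^bold>-x') \<epsilon> J"
    using lattice_idealD(4)[OF lattice_ideal_J, simplified] J(2,1) by blast
  have "x' \<^bold>+ (x \<^bold>+ \<^bold>-x') \<preceq> y' \<^bold>+ (x \<^bold>+ \<^bold>-x')" using le V assms by (simp add: add_right_mono)
  moreover have "x' \<^bold>+ (x \<^bold>+ \<^bold>-x') = x \<^bold>+ (x' \<^bold>+ \<^bold>-x')" using V assms by (intro M.a_lcomm) simp_all
  moreover have "y \<^bold>+ ((y' \<^bold>+ \<^bold>-y) \<^bold>+ (x \<^bold>+ \<^bold>-x')) = (y \<^bold>+ \<^bold>-y) \<^bold>+ (y' \<^bold>+ (x \<^bold>+ \<^bold>-x'))"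
    using V assms by (simp add: M.a_ac)
  ultimately have "x \<preceq> y \<^bold>+ ((y' \<^bold>+ \<^bold>-y) \<^bold>+ (x \<^bold>+ \<^bold>-x'))" using V assms by (simp add: M.r_neg)
  then show "\<exists>i. i \<epsilon> J \<and> x \<preceq> y \<^bold>+ i" using mem by blast
next
  assume "\<exists>i. i \<epsilon> J \<and> x \<preceq> y \<^bold>+ i"
  then obtain i where i: "i \<epsilon> J" "x \<preceq> y \<^bold>+ i" by blast
  have iV: "i \<in> V" using mem_J_carrier[OF i(1)] .
  have "(y \<^bold>+ i) \<^bold>+ \<^bold>-y = i \<^bold>+ (y \<^bold>+ \<^bold>-y)" using iV assms by (simp add: M.a_ac)
  then have "coset (y \<^bold>+ i) = coset y" using i iV assms by (simp add: coset_eq_iff M.r_neg)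
  then show "opair E (coset x) (coset y) \<epsilon> vle quot"
    unfolding mem_vle_quot using i(2) by metis
qed

lemma vlattice_quotient:
  "vlattice_quotient (fring E R) (vmodule E X) (vorder E X) (pos_reals E R) (elts E J)
     (vmodule E quot) (vorder E quot) coset"
proof (intro vlattice_quotient.intro vlattice_quotient_axioms.intro vlattice lattice_ideal_J)
  have carrier: "carrier (vmodule E quot) = coset ` V"
    by (simp add: vmodule_def quot_carrier del: mem_vcarrier)
  then show "carrier (vmodule E quot) = coset ` V" .
  show "carrier (vorder E quot) = coset ` V" by (simp add: vorder_def quot_carrier)
  show "eq (vorder E quot) = (=)" by (simp add: vorder_def)
  show "coset x \<oplus>\<^bsub>vmodule E quot\<^esub> coset y = coset (x \<^bold>+ y)" if "x \<in> V" "y \<in> V" for x y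
  proof -
    have "coset (x \<^bold>+ y) = app E (vadd quot) (opair E (coset x) (coset y))"
      using is_fun_app(2)[OF is_fun_vadd_quot, of "opair E (coset x) (coset y)" "coset (x \<^bold>+ y)"]
      using that by (simp add: vadd_quot_iff)
    moreover have "coset x \<oplus>\<^bsub>vmodule E quot\<^esub> coset y = app E (vadd quot) (opair E (coset x) (coset y))"
      by (simp add: vmodule_def)
    ultimately show ?thesis by simp
  qed
  show "r \<odot>\<^bsub>vmodule E quot\<^esub> coset x = coset (r \<^bold>* x)" if "r \<in> carrier (fring E R)" "x \<in> V" for r x
  proof -
    have "coset (r \<^bold>* x) = app E (vsmult quot) (opair E r (coset x))"
      using is_fun_app(2)[OF is_fun_vsmult_quot, of "opair E r (coset x)" "coset (r \<^bold>* x)"]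
      using that by (simp add: vsmult_quot_iff)
    moreover have "r \<odot>\<^bsub>vmodule E quot\<^esub> coset x = app E (vsmult quot) (opair E r (coset x))"
      by (simp add: vmodule_def)
    ultimately show ?thesis by simp
  qed
  show "\<zero>\<^bsub>vmodule E quot\<^esub> = coset \<^bold>0" unfolding vmodule_def[of E quot] by simp
  show "coset x \<sqsubseteq>\<^bsub>vorder E quot\<^esub> coset y \<longleftrightarrow> (\<exists>i\<in>elts E J. x \<preceq> y \<^bold>+ i)" if "x \<in> V" "y \<in> V" for x y
    using vle_quot_iff[OF that] by (auto simp: vorder_def[of E quot])
  show "coset x = coset y \<longleftrightarrow> x \<^bold>+ \<^bold>-y \<in> elts E J" if "x \<in> V" "y \<in> V" for x y
    using that by (simp add: coset_eq_iff)
qed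

sublocale vlattice_quotient "fring E R" "vmodule E X" "vorder E X" "pos_reals E R" "elts E J"
    "vmodule E quot" "vorder E quot" coset
  by (rule vlattice_quotient)

lemma vector_lattice_quot: "vector_lattice E R quot"
  unfolding vector_lattice_def Let_def
proof (intro conjI ballI impI)
  have [simp]: "elts E (fcarrier R) = carrier (fring E R)" "elts E (vcarrier quot) = coset ` V"
    by (auto simp: quot_carrier)
  show "is_fun E (vadd quot) (pairs E (elts E (vcarrier quot)) (elts E (vcarrier quot))) (elts E (vcarrier quot))"
    by (simp add: quot_carrier is_fun_vadd_quot)
  show "is_fun E (vsmult quot) (pairs E (elts E (fcarrier R)) (elts E (vcarrier quot))) (elts E (vcarrier quot))"
    by (simp add: quot_carrier is_fun_vsmult_quot)
  show "elts E (vle quot) \<subseteq> pairs E (elts E (vcarrier quot)) (elts E (vcarrier quot))"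
  proof
    fix w assume "w \<in> elts E (vle quot)"
    then obtain x y where "x \<preceq> y" and w: "w = opair E (coset x) (coset y)" by (auto simp: mem_vle_quot)
    then have "x \<in> V" "y \<in> V" using below_carrier by simp_all
    then show "w \<in> pairs E (elts E (vcarrier quot)) (elts E (vcarrier quot))" by (simp add: w quot_carrier)
  qed
  show "module (fring E R) (vmodule E quot)" by (rule Q.module_axioms)
  show "lattice (vorder E quot)" by (rule Q.L.lattice_axioms)
qed (auto simp: quot_carrier Q.add_right_mono Q.smult_mono)

sublocale quot: vector_lattice_in_model E R quot
  by unfold_locales (rule reals, rule vector_lattice_quot)

text \<open>
This is the correspondence between the ideals of the quotient and the ideals of \<open>X\<close> that contain \<open>J\<close>,
restricted to ideals that exist in the model.  The preimage of an ideal \<open>N\<close> of the quotient is the union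
of the cosets in \<open>N\<close>.
\<close>
lemma ex_vl_maximal_ideal_if_quot:
  assumes "vl_maximal_ideal E R quot N"
  shows "\<exists>K. vl_maximal_ideal E R X K"
proof -
  have max_N: "Q.lattice_ideal (elts E N) \<and> elts E N \<noteq> coset ` V \<and>
      (\<forall>I. Q.lattice_ideal (elts E I) \<and> elts E N \<subset> elts E I \<longrightarrow> elts E I = coset ` V)"
    using assms unfolding quot.vl_maximal_ideal_iff carrier_M' .
  note N = max_N[THEN conjunct1] max_N[THEN conjunct2, THEN conjunct1]
  have max: "elts E I = coset ` V" if "Q.lattice_ideal (elts E I)" "elts E N \<subset> elts E I" for I
    using max_N that by simp
  have N_sub: "elts E N \<subseteq> coset ` V" using Q.lattice_idealD(1)[OF N(1)] by (simp add: carrier_M')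
  obtain K where K: "\<forall>x. x \<epsilon> K \<longleftrightarrow> (\<exists>c. x \<epsilon> c \<and> c \<epsilon> N)"
    using spec[OF union, of N] by (rule exE)
  have K_iff: "x \<epsilon> K \<longleftrightarrow> x \<in> V \<and> coset x \<epsilon> N" for x
  proof
    assume "x \<epsilon> K"
    then obtain c where c: "x \<epsilon> c" "c \<epsilon> N" using K by blast
    then have "c \<in> coset ` V" using N_sub by auto
    then have "x \<in> V \<and> c = coset x" using c(1) by (rule mem_quot_carrierD)
    then show "x \<in> V \<and> coset x \<epsilon> N" using c(2) by simp
  next
    assume x: "x \<in> V \<and> coset x \<epsilon> N"
    then show "x \<epsilon> K" using K self_mem_coset[of x] by blast
  qed
  then have K_eq: "elts E K = {x \<in> V. coset x \<in> elts E N}" by (simp add: set_eq_iff)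
  have "lattice_ideal (elts E K)" unfolding K_eq by (rule lattice_ideal_preimage[OF N(1)])
  moreover have "elts E K \<noteq> V"
  proof
    assume "elts E K = V"
    then have "coset ` V \<subseteq> elts E N" by (auto simp: K_eq)
    with N_sub N(2) show False by blast
  qed
  moreover have "elts E I = V" if I: "lattice_ideal (elts E I)" "elts E K \<subset> elts E I" for I
  proof -
    have I_V: "elts E I \<subseteq> V" by (rule lattice_idealD(1)[OF I(1)])
    have "i \<epsilon> K" if "i \<epsilon> J" for i
    proof -
      have "coset i = coset \<^bold>0" using that mem_J_carrier[OF that] by (simp add: coset_eq_iff)
      then show ?thesis using Q.lattice_idealD(2)[OF N(1)] mem_J_carrier[OF that] by (simp add: K_iff proj_zero)
    qed
    then have J_I: "elts E J \<subseteq> elts E I" using I(2) by auto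
    obtain C where C: "\<forall>c. c \<epsilon> C \<longleftrightarrow> c \<epsilon> quot_carrier \<and>
        sat E ((\<lambda>_. I)(0 := c)) (fm_Ex 1 (And (Mem 1 2) (Mem 1 0)))"
      using ex_separation[of quot_carrier "\<lambda>_. I"] by (rule exE)
    have "c \<epsilon> C \<longleftrightarrow> c \<in> coset ` elts E I" for c
    proof
      assume "c \<epsilon> C"
      then obtain x where "c \<in> coset ` V" "x \<epsilon> I" "x \<epsilon> c" by (auto simp: C)
      then show "c \<in> coset ` elts E I" using mem_quot_carrierD[of c x] by auto
    next
      assume "c \<in> coset ` elts E I"
      then obtain x where "x \<epsilon> I" "c = coset x" by auto
      moreover then have "x \<in> V" using I_V by auto
      ultimately show "c \<epsilon> C" by (auto simp: C intro: self_mem_coset)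
    qed
    then have C_eq: "elts E C = coset ` elts E I" by auto
    have "Q.lattice_ideal (elts E C)" unfolding C_eq by (rule lattice_ideal_image[OF I(1) J_I])
    moreover have "elts E N \<subset> elts E C"
    proof
      show "elts E N \<subseteq> elts E C"
      proof
        fix c assume c: "c \<in> elts E N"
        then obtain x where "x \<in> V" "c = coset x" using N_sub by blast
        then show "c \<in> elts E C" using c I(2) by (auto simp: C_eq K_eq)
      qed
      obtain x where x: "x \<epsilon> I" "\<not> x \<epsilon> K" using psubset_imp_ex_mem[OF I(2)] by auto
      then have "x \<in> V" using I_V by auto
      then have "\<not> coset x \<epsilon> N" "coset x \<in> elts E C" using x by (auto simp: K_iff C_eq)
      then show "elts E N \<noteq> elts E C" by auto
    qed
    ultimately have "elts E C = coset ` V" by (rule max)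
    then have "coset ` V = coset ` elts E I" using C_eq by simp
    then have "V \<subseteq> elts E I" using mem_if_proj_mem[OF I(1) J_I] by blast
    then show ?thesis using I_V by blast
  qed
  ultimately have "vl_maximal_ideal E R X K" unfolding vl_maximal_ideal_iff by blast
  then show ?thesis by blast
qed

end

section \<open>Truncations and strong units\<close>

context vector_lattice_in_model
begin

text \<open>
Ideals contain 0, so the lattice \<open>{0}\<close> has no proper ideal.
\<close>
lemma not_vl_maximal_ideal_if_trivial:
  assumes "V = {\<^bold>0}"
  shows "\<not> vl_maximal_ideal E R X J"
proof
  assume "vl_maximal_ideal E R X J"
  then have J: "lattice_ideal (elts E J) \<and> elts E J \<noteq> V" unfolding vl_maximal_ideal_iff by (elim conjE, intro conjI)
  then have "elts E J \<subseteq> V" "\<^bold>0 \<in> elts E J" using lattice_idealD(1,2) by (fast, fast)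
  then show False using J assms by (auto simp del: elts_iff)
qed

lemma eq_meet_iff:
  assumes "x \<in> V" "u \<in> V" "y \<in> V"
  shows "y = x \<sqinter>\<^bsub>vorder E X\<^esub> u \<longleftrightarrow>
    y \<preceq> x \<and> y \<preceq> u \<and> (\<forall>c. c \<in> V \<and> c \<preceq> x \<and> c \<preceq> u \<longrightarrow> c \<preceq> y)"
proof
  assume "y = x \<sqinter>\<^bsub>vorder E X\<^esub> u"
  then show "y \<preceq> x \<and> y \<preceq> u \<and> (\<forall>c. c \<in> V \<and> c \<preceq> x \<and> c \<preceq> u \<longrightarrow> c \<preceq> y)"
    using assms by (simp add: meet_below1 meet_below2 below_meet)
next
  assume y: "y \<preceq> x \<and> y \<preceq> u \<and> (\<forall>c. c \<in> V \<and> c \<preceq> x \<and> c \<preceq> u \<longrightarrow> c \<preceq> y)"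
  show "y = x \<sqinter>\<^bsub>vorder E X\<^esub> u"
  proof (rule below_antisym)
    show "y \<preceq> x \<sqinter>\<^bsub>vorder E X\<^esub> u" using y assms by (simp add: below_meet)
    show "x \<sqinter>\<^bsub>vorder E X\<^esub> u \<preceq> y" using y assms by (simp add: meet_below1 meet_below2)
  qed (use assms in simp_all)
qed

lemma ex_meet_fun:
  assumes u: "u \<in> V" "\<^bold>0 \<preceq> u"
  shows "\<exists>t. is_fun E t (pos_cone E X) (pos_cone E X) \<and>
    (\<forall>x\<in>pos_cone E X. app E t x = x \<sqinter>\<^bsub>vorder E X\<^esub> u)"
proof -
  \<comment> \<open>variable 3 is left at its default \<open>u\<close>; the formula says that variable 2 is the meet of variable 1 and \<open>u\<close>\<close>
  let ?s = "(\<lambda>_. u)(4 := vcarrier X, 5 := vle X, 6 := \<^bold>0)"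
  let ?p = "And (Pair_mem 6 1 5) (And (Pair_mem 2 1 5) (And (Pair_mem 2 3 5)
     (All 7 (fm_Imp (And (Mem 7 4) (And (Pair_mem 7 1 5) (Pair_mem 7 3 5))) (Pair_mem 7 2 5)))))"
  obtain t where t: "\<forall>w. w \<epsilon> t \<longleftrightarrow> (\<exists>x y. x \<epsilon> vcarrier X \<and> y \<epsilon> vcarrier X \<and> w = opair E x y \<and>
      sat E (?s(0 := w, 1 := x, 2 := y)) ?p)"
    using ex_relation[of "vcarrier X" "vcarrier X" ?s ?p] by (rule exE)
  have sat: "sat E (?s(0 := w, 1 := x, 2 := y)) ?p \<longleftrightarrow> \<^bold>0 \<preceq> x \<and> y = x \<sqinter>\<^bsub>vorder E X\<^esub> u"
    if "x \<in> V" "y \<in> V" for w x y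
    using eq_meet_iff[OF that(1) u(1) that(2)] by (simp add: vle_iff)
  have "w \<epsilon> t \<longleftrightarrow> (\<exists>x\<in>pos_cone E X. w = opair E x (x \<sqinter>\<^bsub>vorder E X\<^esub> u))" for w
  proof
    assume "w \<epsilon> t"
    then have "\<exists>x y. x \<epsilon> vcarrier X \<and> y \<epsilon> vcarrier X \<and> w = opair E x y \<and>
      sat E (?s(0 := w, 1 := x, 2 := y)) ?p" by (rule t[THEN spec, THEN iffD1])
    then obtain x y where "x \<in> V" "y \<in> V" "w = opair E x y" "sat E (?s(0 := w, 1 := x, 2 := y)) ?p"
      unfolding mem_vcarrier by (elim exE conjE)
    then show "\<exists>x\<in>pos_cone E X. w = opair E x (x \<sqinter>\<^bsub>vorder E X\<^esub> u)"
      using sat[of x y w] by (intro bexI[of _ x]) simp_all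
  next
    assume "\<exists>x\<in>pos_cone E X. w = opair E x (x \<sqinter>\<^bsub>vorder E X\<^esub> u)"
    then obtain x where x: "x \<in> V" "\<^bold>0 \<preceq> x" and w: "w = opair E x (x \<sqinter>\<^bsub>vorder E X\<^esub> u)" by auto
    define y where "y = x \<sqinter>\<^bsub>vorder E X\<^esub> u"
    have "y \<in> V" "sat E (?s(0 := w, 1 := x, 2 := y)) ?p" using x u sat[of x y w] by (simp_all add: y_def)
    then have "\<exists>x y. x \<epsilon> vcarrier X \<and> y \<epsilon> vcarrier X \<and> w = opair E x y \<and>
      sat E (?s(0 := w, 1 := x, 2 := y)) ?p"
      unfolding mem_vcarrier using x(1) w[folded y_def] by (intro exI conjI)
    then show "w \<epsilon> t" by (rule t[THEN spec, THEN iffD2])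
  qed
  note graph = is_fun_graph[of t "pos_cone E X" "\<lambda>x. x \<sqinter>\<^bsub>vorder E X\<^esub> u" "pos_cone E X", OF this]
  have "x \<sqinter>\<^bsub>vorder E X\<^esub> u \<in> pos_cone E X" if "x \<in> pos_cone E X" for x
    using that u by (simp add: below_meet)
  then show ?thesis using graph by blast
qed

text \<open>
The truncation is \<open>x \<mapsto> x \<sqinter> u\<close>.  It is strong because \<open>x \<le> r u\<close> makes \<open>x/r\<close> a fixed point.
\<close>
lemma ex_strong_truncation_if_strong_unit:
  assumes "strong_unit E R X u"
  shows "\<exists>t. strong_truncation E R X t \<and>
    (\<forall>x\<in>pos_cone E X. app E t x = x \<sqinter>\<^bsub>vorder E X\<^esub> u)"
proof -
  have "u \<in> V \<and> \<^bold>0 \<preceq> u \<and> (\<forall>x\<in>V. \<exists>r\<in>pos_reals E R. \<^bold>|x\<^bold>| \<preceq> r \<^bold>* u)"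
    using assms unfolding strong_unit_iff .
  note u = this[THEN conjunct1] this[THEN conjunct2, THEN conjunct1]
    and unit = this[THEN conjunct2, THEN conjunct2, THEN bspec]
  obtain t where is_fun: "is_fun E t (pos_cone E X) (pos_cone E X)"
      and t: "\<And>x. x \<in> pos_cone E X \<Longrightarrow> app E t x = x \<sqinter>\<^bsub>vorder E X\<^esub> u"
    using ex_meet_fun[OF u] by blast
  have assoc: "(x \<sqinter>\<^bsub>vorder E X\<^esub> u) \<sqinter>\<^bsub>vorder E X\<^esub> y = x \<sqinter>\<^bsub>vorder E X\<^esub> (y \<sqinter>\<^bsub>vorder E X\<^esub> u)"
    if "x \<in> V" "y \<in> V" for x y
    using L.weak_meet_assoc[of x u y] that u meet_comm[of "vorder E X" u y]
    by (simp add: carrier_L L.eq_is_equal)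
  have "\<exists>s\<in>pos_reals E R. app E t (s \<^bold>* x) = s \<^bold>* x" if "x \<in> pos_cone E X" for x
  proof -
    have x: "x \<in> V" "\<^bold>0 \<preceq> x" using that by simp_all
    obtain r where r: "r \<in> pos_reals E R" "x \<preceq> r \<^bold>* u"
      using unit[OF x(1)] by (auto simp: modulus_of_nonneg x)
    obtain s where s: "s \<in> pos_reals E R" "\<And>x. x \<in> V \<Longrightarrow> s \<^bold>* (r \<^bold>* x) = x" using Pos_divide r(1) by blast
    have "s \<^bold>* x \<preceq> u" using smult_mono[OF s(1) x(1) _ r(2)] s r u by simp
    moreover have "s \<^bold>* \<^bold>0 \<preceq> s \<^bold>* x" using smult_mono[OF s(1) _ x(1) x(2)] by simp
    then have "\<^bold>0 \<preceq> s \<^bold>* x" using s(1) Pos_carrier by auto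
    ultimately have "app E t (s \<^bold>* x) = s \<^bold>* x" using s(1) x u by (simp add: t meet_absorb)
    then show ?thesis using s(1) by blast
  qed
  then have "strong_truncation E R X t"
    unfolding strong_truncation_def truncation_def using is_fun by (simp add: t assoc)
  then show ?thesis using t by blast
qed

text \<open>
The element \<open>2u\<close> is moved: otherwise \<open>2u \<le> u\<close>, so \<open>u = 0\<close>, and 0 is a strong unit of \<open>{0}\<close> only.
\<close>
lemma meet_unit_not_identity:
  assumes u: "strong_unit E R X u" and nontrivial: "V \<noteq> {\<^bold>0}"
  shows "\<exists>x\<in>pos_cone E X. x \<sqinter>\<^bsub>vorder E X\<^esub> u \<noteq> x"
proof (rule ccontr)
  assume contra: "\<not> ?thesis"
  have "u \<in> V \<and> \<^bold>0 \<preceq> u \<and> (\<forall>x\<in>V. \<exists>r\<in>pos_reals E R. \<^bold>|x\<^bold>| \<preceq> r \<^bold>* u)"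
    using u unfolding strong_unit_iff .
  note u = this[THEN conjunct1] this[THEN conjunct2, THEN conjunct1]
    and unit = this[THEN conjunct2, THEN conjunct2, THEN bspec]
  have "\<^bold>0 \<preceq> u \<^bold>+ u" using add_mono[of "\<^bold>0" u "\<^bold>0" u] u by simp
  then have "u \<^bold>+ u = (u \<^bold>+ u) \<sqinter>\<^bsub>vorder E X\<^esub> u" using contra u by simp
  then have "u \<^bold>+ u \<preceq> \<^bold>0 \<^bold>+ u" using meet_below2[of "u \<^bold>+ u" u] u by simp
  then have "u \<preceq> \<^bold>0" using add_right_cancel[of u "\<^bold>0" u] u by blast
  then have u0: "u = \<^bold>0" using below_antisym u by blast
  have "x = \<^bold>0" if x: "x \<in> V" for x
  proof -
    obtain r where r: "r \<in> pos_reals E R" "\<^bold>|x\<^bold>| \<preceq> r \<^bold>* u" using unit[OF x] by blast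
    have "r \<^bold>* u = \<^bold>0" using r(1) Pos_carrier by (auto simp: u0)
    then have "x \<preceq> \<^bold>0" "\<^bold>-x \<preceq> \<^bold>0" using r(2) x by (simp_all add: modulus_below_iff)
    then show ?thesis using neg_mono[of "\<^bold>-x" "\<^bold>0"] below_antisym[of x "\<^bold>0"] x by simp
  qed
  then have "V = {\<^bold>0}" by auto
  with nontrivial show False ..
qed

text \<open>
Let \<open>b\<close> be the truncation of \<open>a\<close> and \<open>e = a - b > 0\<close>.  The lattice \<open>X\<close> itself may be without strong unit, but
the quotient by the polar of \<open>e\<close> has one, namely the class of \<open>b\<close>: a multiple \<open>w\<close> of \<open>|x|\<close> is a fixed point
of the truncation, and by the lemma \<open>fixed_point_excess_in_polar\<close> it exceeds \<open>b\<close> by an element of the polar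
at most.  The quotient is not trivial, as \<open>e\<close> is not in its own polar.
\<close>
lemma ex_vl_maximal_ideal_if_strong_truncation:
  assumes t: "strong_truncation E R X t" and a: "a \<in> pos_cone E X" "app E t a \<noteq> a"
    and U: "statement_U_nondegenerate E R"
  shows "\<exists>J. vl_maximal_ideal E R X J"
proof -
  have trunc: "app E t x \<sqinter>\<^bsub>vorder E X\<^esub> y = x \<sqinter>\<^bsub>vorder E X\<^esub> app E t y"
    if "x \<in> pos_cone E X" "y \<in> pos_cone E X" for x y
    using t that unfolding strong_truncation_def truncation_def by blast
  have closed: "app E t x \<in> pos_cone E X" if "x \<in> pos_cone E X" for x
    using t that is_fun_app(1) unfolding strong_truncation_def truncation_def by blast
  have strong: "\<exists>r\<in>pos_reals E R. app E t (r \<^bold>* x) = r \<^bold>* x" if "x \<in> pos_cone E X" for x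
    using t that unfolding strong_truncation_def by blast
  define b where "b = app E t a"
  have aV: "a \<in> V" using a by simp
  have b: "b \<in> V" "\<^bold>0 \<preceq> b" using closed[OF a(1)] by (simp_all add: b_def)
  \<comment> \<open>truncated elements lie below the original: apply the defining identity to \<open>a\<close> and \<open>b\<close>\<close>
  have "b = b \<sqinter>\<^bsub>vorder E X\<^esub> b" using b by (simp add: meet_absorb)
  also have "\<dots> = a \<sqinter>\<^bsub>vorder E X\<^esub> app E t b" using trunc[OF a(1), of b] b by (simp add: b_def)
  also have "\<dots> \<preceq> a" using closed[of b] b aV by (simp add: meet_below1)
  finally have ba: "b \<preceq> a" .
  define e where "e = a \<^bold>+ \<^bold>-b"
  have eV: "e \<in> V" using aV b by (simp add: e_def)
  have eb: "e \<^bold>+ b = a" using aV b by (simp add: e_def M.a_assoc M.l_neg)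
  have e0: "\<^bold>0 \<preceq> e" using add_right_cancel[of "\<^bold>0" e b] eb ba b eV by simp
  have "e \<noteq> \<^bold>0" using eb a(2) b by (auto simp: b_def)
  obtain J where J: "elts E J = polar e" using ex_polar by blast
  interpret Q: quotient_in_model E R X J
    by unfold_locales (simp add: J lattice_ideal_polar[OF eV e0])
  have "strong_unit E R Q.quot (Q.coset b)"
    unfolding Q.quot.strong_unit_iff
  proof (intro conjI ballI)
    show "Q.coset b \<in> carrier (vmodule E Q.quot)" using b by simp
    show "\<zero>\<^bsub>vmodule E Q.quot\<^esub> \<sqsubseteq>\<^bsub>vorder E Q.quot\<^esub> Q.coset b"
      using Q.proj_mono[of "\<^bold>0" b] b by (simp add: Q.proj_zero)
    fix p assume "p \<in> carrier (vmodule E Q.quot)"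
    then obtain x where x: "x \<in> V" "p = Q.coset x" by (auto simp: Q.carrier_M')
    have absx: "\<^bold>|x\<^bold>| \<in> V" "\<^bold>0 \<preceq> \<^bold>|x\<^bold>|" using modulus_nonneg[OF x(1)] x by simp_all
    obtain r where r: "r \<in> pos_reals E R" "app E t (r \<^bold>* \<^bold>|x\<^bold>|) = r \<^bold>* \<^bold>|x\<^bold>|" using strong[of "\<^bold>|x\<^bold>|"] absx by auto
    define w where "w = r \<^bold>* \<^bold>|x\<^bold>|"
    have rR: "r \<in> carrier (fring E R)" using r(1) Pos_carrier by blast
    have w: "w \<in> V" "\<^bold>0 \<preceq> w" "app E t w = w"
      using smult_mono[OF r(1) _ absx(1) absx(2)] r rR absx by (simp_all add: w_def)
    have "w \<sqinter>\<^bsub>vorder E X\<^esub> a = w \<sqinter>\<^bsub>vorder E X\<^esub> b"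
      using trunc[of w a] w a(1) by (simp add: b_def)
    then have i: "w \<^bold>+ \<^bold>-(w \<sqinter>\<^bsub>vorder E X\<^esub> b) \<in> polar e"
      unfolding e_def using fixed_point_excess_in_polar[of w a b] w aV b ba by blast
    define i where "i = w \<^bold>+ \<^bold>-(w \<sqinter>\<^bsub>vorder E X\<^esub> b)"
    have iV: "i \<in> V" using w b by (simp add: i_def)
    have "w = w \<sqinter>\<^bsub>vorder E X\<^esub> b \<^bold>+ i"
    proof -
      have "w \<sqinter>\<^bsub>vorder E X\<^esub> b \<^bold>+ (w \<^bold>+ \<^bold>-(w \<sqinter>\<^bsub>vorder E X\<^esub> b)) = w \<^bold>+ (w \<sqinter>\<^bsub>vorder E X\<^esub> b \<^bold>+ \<^bold>-(w \<sqinter>\<^bsub>vorder E X\<^esub> b))"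
        using w b by (intro M.a_lcomm) simp_all
      then show ?thesis using w b by (simp add: i_def M.r_neg)
    qed
    also have "\<dots> \<preceq> b \<^bold>+ i" using w b iV by (intro add_right_mono meet_below2) simp_all
    finally have "w \<preceq> b \<^bold>+ i" .
    then have le: "Q.coset w \<sqsubseteq>\<^bsub>vorder E Q.quot\<^esub> Q.coset b"
      using Q.proj_belowI[of w b i] w b i J by (simp add: i_def[symmetric] set_eq_iff)
    obtain s where s: "s \<in> pos_reals E R" "\<And>x. x \<in> V \<Longrightarrow> s \<^bold>* (r \<^bold>* x) = x" using Pos_divide r(1) by blast
    have "s \<in> carrier (fring E R)" using s(1) Pos_carrier by blast
    then have "s \<odot>\<^bsub>vmodule E Q.quot\<^esub> Q.coset w = Q.coset \<^bold>|x\<^bold>|"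
      using w(1) s(2)[OF absx(1)] by (simp add: Q.proj_smult w_def)
    then have "Q.Q.modulus p \<sqsubseteq>\<^bsub>vorder E Q.quot\<^esub> s \<odot>\<^bsub>vmodule E Q.quot\<^esub> Q.coset b"
      using Q.Q.smult_mono[OF s(1) _ _ le] w b x by (simp add: Q.proj_modulus)
    then show "\<exists>s\<in>pos_reals E R. Q.Q.modulus p \<sqsubseteq>\<^bsub>vorder E Q.quot\<^esub> s \<odot>\<^bsub>vmodule E Q.quot\<^esub> Q.coset b"
      using s(1) by blast
  qed
  moreover have "elts E (vcarrier Q.quot) \<noteq> {vzero Q.quot}"
  proof
    assume trivial: "elts E (vcarrier Q.quot) = {vzero Q.quot}"
    have "Q.coset e \<in> elts E (vcarrier Q.quot)" using eV by simp
    then have "Q.coset e = Q.coset \<^bold>0" unfolding trivial by simp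
    then have "e \<in> polar e" using Q.coset_eq_iff[of e "\<^bold>0"] eV J by (simp add: set_eq_iff)
    then show False using self_in_polar_iff[OF eV e0] \<open>e \<noteq> \<^bold>0\<close> by blast
  qed
  ultimately have "\<exists>N. vl_maximal_ideal E R Q.quot N"
    using U Q.vector_lattice_quot unfolding statement_U_nondegenerate_def by blast
  then show ?thesis using Q.ex_vl_maximal_ideal_if_quot by blast
qed

text \<open>
The quotient of any vector lattice by itself is \<open>{0}\<close>, in which 0 is a strong unit.
\<close>
lemma not_statement_U: "\<not> statement_U E R"
proof
  assume U: "statement_U E R"
  have J: "elts E (vcarrier X) = V" by (rule carrier_vmodule)
  interpret Q: quotient_in_model E R X "vcarrier X"
    by unfold_locales (simp only: J lattice_ideal_carrier)
  have trivial: "carrier (vmodule E Q.quot) = {\<zero>\<^bsub>vmodule E Q.quot\<^esub>}"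
  proof -
    have "Q.coset x = Q.coset \<^bold>0" if "x \<in> V" for x using that by (simp add: Q.coset_eq_iff)
    then have "Q.coset ` V \<subseteq> {Q.coset \<^bold>0}" by blast
    moreover have "Q.coset \<^bold>0 \<in> Q.coset ` V" by (rule imageI) simp
    ultimately have "Q.coset ` V = {Q.coset \<^bold>0}" by blast
    then show ?thesis unfolding Q.carrier_M' Q.proj_zero by simp
  qed
  have "Q.Q.modulus (\<zero>\<^bsub>vmodule E Q.quot\<^esub>) = \<zero>\<^bsub>vmodule E Q.quot\<^esub>"
    by (rule Q.Q.modulus_of_nonneg) simp_all
  then have "strong_unit E R Q.quot (\<zero>\<^bsub>vmodule E Q.quot\<^esub>)"
    unfolding Q.quot.strong_unit_iff trivial
    using Pos_one by (simp, intro bexI[of _ "\<one>\<^bsub>fring E R\<^esub>"]) simp_all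
  then have "\<exists>N. vl_maximal_ideal E R Q.quot N"
    using U Q.vector_lattice_quot unfolding statement_U_def by blast
  then show False using Q.quot.not_vl_maximal_ideal_if_trivial[OF trivial] by blast
qed

end

section \<open>The equivalence\<close>

theorem theorem1:
  fixes E :: "'v \<Rightarrow> 'v \<Rightarrow> bool"
    and R :: "'v ordered_field_sys"
  assumes "ZF_model E"
    and "is_reals E R"
  shows "(statement_T E R \<longleftrightarrow> statement_U E R) \<and>
    (statement_T_nondegenerate E R \<longleftrightarrow> statement_U_nondegenerate E R)"
proof -
  have in_model: "vector_lattice_in_model E R X" if "vector_lattice E R X" for X
    using that assms by (intro vector_lattice_in_model.intro vector_lattice_in_model_axioms.intro)
  have TU: "statement_U E R" if T: "statement_T E R"
    unfolding statement_U_def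
  proof (intro allI impI, elim conjE)
    fix X u assume X: "vector_lattice E R X" "strong_unit E R X u"
    obtain t where "strong_truncation E R X t"
      using vector_lattice_in_model.ex_strong_truncation_if_strong_unit[OF in_model[OF X(1)] X(2)]
      by (elim exE conjE)
    with X(1) have "vector_lattice E R X \<and> strong_truncation E R X t" ..
    then show "\<exists>J. vl_maximal_ideal E R X J"
      by (rule T[unfolded statement_T_def, THEN spec, THEN spec, THEN mp])
  qed
  have UT: "statement_T E R" if U: "statement_U E R"
    unfolding statement_T_def
  proof (intro allI impI, elim conjE)
    fix X t assume "vector_lattice E R X"
    from vector_lattice_in_model.not_statement_U[OF in_model[OF this]] U
    show "\<exists>J. vl_maximal_ideal E R X J" by (rule notE)
  qed
  have TU': "statement_U_nondegenerate E R" if T: "statement_T_nondegenerate E R"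
    unfolding statement_U_nondegenerate_def
  proof (intro allI impI, elim conjE)
    fix X u
    assume X: "vector_lattice E R X" "elts E (vcarrier X) \<noteq> {vzero X}" "strong_unit E R X u"
    interpret X: vector_lattice_in_model E R X by (rule in_model[OF X(1)])
    obtain t where t: "strong_truncation E R X t"
        "\<forall>x\<in>pos_cone E X. app E t x = x \<sqinter>\<^bsub>vorder E X\<^esub> u"
      using X.ex_strong_truncation_if_strong_unit[OF X(3)] by (elim exE conjE)
    obtain x where x: "x \<in> pos_cone E X" "x \<sqinter>\<^bsub>vorder E X\<^esub> u \<noteq> x"
      using X.meet_unit_not_identity[OF X(3) X(2)[unfolded X.carrier_vmodule X.vzero_eq]] by (elim bexE)
    have "app E t x \<noteq> x" using t(2) x by simp
    with x(1) have "\<exists>x\<in>pos_cone E X. app E t x \<noteq> x" by (rule bexI[rotated])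
    with X(1,2) t(1) have "vector_lattice E R X \<and> elts E (vcarrier X) \<noteq> {vzero X} \<and>
        strong_truncation E R X t \<and> (\<exists>x\<in>pos_cone E X. app E t x \<noteq> x)"
      by (intro conjI)
    then show "\<exists>J. vl_maximal_ideal E R X J"
      by (rule T[unfolded statement_T_nondegenerate_def, THEN spec, THEN spec, THEN mp])
  qed
  have UT': "statement_T_nondegenerate E R" if U: "statement_U_nondegenerate E R"
    unfolding statement_T_nondegenerate_def
  proof (intro allI impI, elim conjE bexE)
    fix X t x
    assume X: "vector_lattice E R X" "strong_truncation E R X t"
      and x: "x \<in> pos_cone E X" "app E t x \<noteq> x"
    show "\<exists>J. vl_maximal_ideal E R X J"
      by (rule vector_lattice_in_model.ex_vl_maximal_ideal_if_strong_truncation[OF in_model[OF X(1)] X(2) x U])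
  qed
  show ?thesis by (intro conjI iffI; erule TU UT TU' UT')
qed

end
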